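(* Let $\emptyset\neq\mathscr{B}\subset\mathbb{N}\setminus\{1\}$ be primitive. The following conditions are equivalent. (a) There exists a nontrivial automorphism of $\mathbb{A}_{\mathscr{B}}$, i.e. an element of $\mathrm{Aut}(\mathbb{A}_{\mathscr{B}})$ that is not of the form $\sigma^n$, $n\in\mathbb{Z}$. (b) The group $\mathrm{Aut}(\{0,1\}^{\mathbb{Z}})$ embeds into $\mathrm{Aut}(\mathbb{A}_{\mathscr{B}})$, i.e. there is an injective group homomorphism $\mathrm{Aut}(\{0,1\}^{\mathbb{Z}})\to\mathrm{Aut}(\mathbb{A}_{\mathscr{B}})$. (c) There exist a finite set $S\subseteq\mathscr{B}$ and an $S$-tuple $\mathbf{r}=(r_b)_{b\in S}\in\mathbb{Z}^S$ of integers such that the set $K_{\mathbf{r}}:=\bigcup_{b\in S}(r_b+b\mathbb{Z})$ is minimal (with respect to inclusion) among all sets of the form $\bigcup_{b\in S}(r'_b+b\mathbb{Z})$, where $(r'_b)_{b\in S}\in\mathbb{Z}^S$, and the set $\mathbb{Z}\setminus K_{\mathbf{r}}$ is $\mathscr{B}$-admissible.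
   Context: A set $\mathscr{B}\subset\mathbb{N}$ is primitive if $b\nmid b'$ for all distinct $b,b'\in\mathscr{B}$. A subshift is a closed subset $X\subseteq\{0,1\}^{\mathbb{Z}}$ invariant under the left shift $\sigma$, $(\sigma x)[n]=x[n+1]$. $\mathrm{Aut}(X)$ is the group, under composition, of all homeomorphisms $X\to X$ commuting with $\sigma$. A set $A\subset\mathbb{Z}$ is $\mathscr{B}$-admissible if for every $b\in\mathscr{B}$ one has $|A \bmod b|<b$, i.e. $A$ misses at least one residue class modulo $b$. A sequence $x\in\{0,1\}^{\mathbb{Z}}$ is $\mathscr{B}$-admissible if its support $\{n\in\mathbb{Z}:x[n]\neq0\}$ is $\mathscr{B}$-admissible. $\mathbb{A}_{\mathscr{B}}$ denotes the subshift of all $\mathscr{B}$-admissible sequences in $\{0,1\}^{\mathbb{Z}}$. *)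

theory Defs
  imports "HOL-Analysis.Analysis" "HOL-Algebra.Bij" "HOL-Number_Theory.Cong"
begin

text \<open>
  The two-sided full 2-shift is the whole type \<^typ>\<open>int \<Rightarrow> bool\<close>
  (\<^const>\<open>True\<close> is the symbol 1), whose type class topology is the product of discrete
  topologies.
\<close>

definition shift :: "(int \<Rightarrow> bool) \<Rightarrow> (int \<Rightarrow> bool)" where
  "shift x = (\<lambda>n. x (n + 1))"

definition subshift :: "(int \<Rightarrow> bool) set \<Rightarrow> bool" where
  "subshift X \<longleftrightarrow> closed X \<and> shift ` X = X"

text \<open>
  As in \<^const>\<open>AutoGroup\<close>, the elements of \<open>Aut X\<close> are extensional functions,
  so that a self-map of \<open>X\<close> is represented by exactly one HOL function.
\<close>

definition shift_auts :: "(int \<Rightarrow> bool) set \<Rightarrow> ((int \<Rightarrow> bool) \<Rightarrow> (int \<Rightarrow> bool)) set" where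
  "shift_auts X = {f \<in> Bij X. homeomorphic_map (top_of_set X) (top_of_set X) f \<and>
     (\<forall>x\<in>X. f (shift x) = shift (f x))}"

definition Aut :: "(int \<Rightarrow> bool) set \<Rightarrow> ((int \<Rightarrow> bool) \<Rightarrow> (int \<Rightarrow> bool)) monoid" where
  "Aut X = BijGroup X \<lparr>carrier := shift_auts X\<rparr>"

definition primitive :: "nat set \<Rightarrow> bool" where
  "primitive B \<longleftrightarrow> (\<forall>b\<in>B. \<forall>b'\<in>B. b \<noteq> b' \<longrightarrow> \<not> b dvd b')"

text \<open>
  For \<open>b > 0\<close> the set of residues is finite, so \<^const>\<open>card\<close> is its true size; moduli \<open>0\<close>
  are not meant (\<open>B\<close> consists of positive integers).
\<close>

definition admissible :: "nat set \<Rightarrow> int set \<Rightarrow> bool" where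
  "admissible B A \<longleftrightarrow> (\<forall>b\<in>B. card ((\<lambda>n. n mod int b) ` A) < b)"

definition admissible_shift :: "nat set \<Rightarrow> (int \<Rightarrow> bool) set" where
  "admissible_shift B = {x. admissible B {n. x n}}"

text \<open>Only the values of \<open>r\<close> on \<open>S\<close> matter, so \<open>r\<close> stands for an \<open>S\<close>-tuple of integers.\<close>

definition residue_union :: "nat set \<Rightarrow> (nat \<Rightarrow> int) \<Rightarrow> int set" where
  "residue_union S r = (\<Union>b\<in>S. range (\<lambda>k. r b + int b * k))"

lemma subshift_UNIV: "subshift UNIV"
proof -
  have "x \<in> range shift" for x
    by (rule image_eqI[of _ _ "\<lambda>n. x (n - 1)"]) (auto simp: shift_def)
  then show ?thesis by (auto simp: subshift_def)
qed

lemma inj_shift: "inj shift"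
proof (rule injI)
  fix x y assume "shift x = shift y"
  then have "x (n - 1 + 1) = y (n - 1 + 1)" for n
    unfolding shift_def by metis
  then show "x = y" by auto
qed

lemma admissible_iff_misses_residue:
  assumes "\<forall>b\<in>B. b > 0"
  shows "admissible B A \<longleftrightarrow> (\<forall>b\<in>B. \<exists>r. \<forall>n\<in>A. \<not> [n = r] (mod int b))"
  unfolding admissible_def
proof (intro ball_cong refl)
  fix b assume "b \<in> B"
  then have b: "int b > 0" using assms by auto
  have sub: "(\<lambda>n. n mod int b) ` A \<subseteq> {0..<int b}" using b by auto
  have "card ((\<lambda>n. n mod int b) ` A) < b \<longleftrightarrow> (\<lambda>n. n mod int b) ` A \<noteq> {0..<int b}"
    using sub psubset_card_mono[of "{0..<int b}" "(\<lambda>n. n mod int b) ` A"] by auto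
  also have "\<dots> \<longleftrightarrow> (\<exists>r. \<forall>n\<in>A. \<not> [n = r] (mod int b))"
  proof
    assume "(\<lambda>n. n mod int b) ` A \<noteq> {0..<int b}"
    then obtain r where "r \<in> {0..<int b}" "r \<notin> (\<lambda>n. n mod int b) ` A" using sub by blast
    then show "\<exists>r. \<forall>n\<in>A. \<not> [n = r] (mod int b)"
      by (intro exI[of _ r]) (auto simp: cong_def)
  next
    assume "\<exists>r. \<forall>n\<in>A. \<not> [n = r] (mod int b)"
    then obtain r where "\<forall>n\<in>A. \<not> [n = r] (mod int b)" by blast
    then have "r mod int b \<notin> (\<lambda>n. n mod int b) ` A" by (auto simp: cong_def)
    moreover have "r mod int b \<in> {0..<int b}" using b by auto
    ultimately show "(\<lambda>n. n mod int b) ` A \<noteq> {0..<int b}" by blast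
  qed
  finally show "card ((\<lambda>n. n mod int b) ` A) < b \<longleftrightarrow> (\<exists>r. \<forall>n\<in>A. \<not> [n = r] (mod int b))" .
qed

lemma shift_mem_admissible_shift:
  assumes "\<forall>b\<in>B. b > 0"
  shows "shift x \<in> admissible_shift B \<longleftrightarrow> x \<in> admissible_shift B"
proof -
  have "(\<exists>r. \<forall>n\<in>{n. shift x n}. \<not> [n = r] (mod int b)) \<longleftrightarrow>
        (\<exists>r. \<forall>n\<in>{n. x n}. \<not> [n = r] (mod int b))" for b
  proof
    assume "\<exists>r. \<forall>n\<in>{n. shift x n}. \<not> [n = r] (mod int b)"
    then obtain r where r: "\<And>n. x (n + 1) \<Longrightarrow> \<not> [n = r] (mod int b)"
      by (auto simp: shift_def)
    show "\<exists>r. \<forall>n\<in>{n. x n}. \<not> [n = r] (mod int b)"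
    proof (intro exI[of _ "r + 1"] ballI notI)
      fix n assume "n \<in> {n. x n}" "[n = r + 1] (mod int b)"
      then show False using r[of "n - 1"] by (auto simp: cong_iff_dvd_diff algebra_simps)
    qed
  next
    assume "\<exists>r. \<forall>n\<in>{n. x n}. \<not> [n = r] (mod int b)"
    then obtain r where r: "\<And>n. x n \<Longrightarrow> \<not> [n = r] (mod int b)" by auto
    show "\<exists>r. \<forall>n\<in>{n. shift x n}. \<not> [n = r] (mod int b)"
    proof (intro exI[of _ "r - 1"] ballI notI)
      fix n assume "n \<in> {n. shift x n}" "[n = r - 1] (mod int b)"
      then show False using r[of "n + 1"] by (auto simp: shift_def cong_iff_dvd_diff algebra_simps)
    qed
  qed
  then show ?thesis
    by (simp add: admissible_shift_def admissible_iff_misses_residue[OF assms])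
qed

lemma closed_coordinate_zero: "closed {x :: int \<Rightarrow> bool. \<not> x n}"
proof -
  have "{x :: int \<Rightarrow> bool. \<not> x n} = (\<lambda>x. x n) -` {False}" by auto
  moreover have "closed ((\<lambda>x :: int \<Rightarrow> bool. x n) -` {False})"
    by (intro closed_vimage closed_singleton continuous_on_product_coordinates)
  ultimately show ?thesis by simp
qed

lemma subshift_admissible_shift:
  assumes "\<forall>b\<in>B. b > 0"
  shows "subshift (admissible_shift B)"
proof -
  have "admissible_shift B =
      (\<Inter>b\<in>B. \<Union>r\<in>{0..<int b}. \<Inter>n\<in>{n. [n = r] (mod int b)}. {x. \<not> x n})" (is "_ = ?R")
  proof (rule Set.set_eqI)
    fix x
    have "(\<exists>r. \<forall>n\<in>{n. x n}. \<not> [n = r] (mod int b)) \<longleftrightarrow>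
        (\<exists>r\<in>{0..<int b}. \<forall>n. [n = r] (mod int b) \<longrightarrow> \<not> x n)" if "b \<in> B" for b
    proof
      assume "\<exists>r. \<forall>n\<in>{n. x n}. \<not> [n = r] (mod int b)"
      then obtain r where "\<forall>n\<in>{n. x n}. \<not> [n = r] (mod int b)" by blast
      then show "\<exists>r\<in>{0..<int b}. \<forall>n. [n = r] (mod int b) \<longrightarrow> \<not> x n"
        using assms that by (intro bexI[of _ "r mod int b"]) (auto simp: cong_def)
    qed auto
    then show "x \<in> admissible_shift B \<longleftrightarrow> x \<in> ?R"
      by (auto simp: admissible_shift_def admissible_iff_misses_residue[OF assms])
  qed
  moreover have "closed ?R"
    by (intro closed_INT ballI closed_UN closed_coordinate_zero) auto
  moreover have "shift ` admissible_shift B = admissible_shift B"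
  proof (intro equalityI subsetI)
    fix x assume "x \<in> admissible_shift B"
    moreover obtain y where "x = shift y"
      using subshift_UNIV unfolding subshift_def by blast
    ultimately show "x \<in> shift ` admissible_shift B"
      using shift_mem_admissible_shift[OF assms] by blast
  qed (use shift_mem_admissible_shift[OF assms] in auto)
  ultimately show ?thesis by (simp add: subshift_def)
qed

lemma subgroup_shift_auts:
  assumes "shift ` X = X"
  shows "subgroup (shift_auts X) (BijGroup X)"
proof (rule group.subgroupI[OF group_BijGroup])
  show "shift_auts X \<subseteq> carrier (BijGroup X)"
    by (auto simp: shift_auts_def BijGroup_def)
  have "(\<lambda>x\<in>X. x) \<in> shift_auts X"
    using assms homeomorphic_map_eq[OF homeomorphic_map_id[THEN iffD2, OF refl], of "top_of_set X" "\<lambda>x\<in>X. x"]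
    by (auto simp: shift_auts_def id_Bij)
  then show "shift_auts X \<noteq> {}" by blast
next
  fix f assume f: "f \<in> shift_auts X"
  then have bij: "f \<in> Bij X" and hom: "homeomorphic_map (top_of_set X) (top_of_set X) f"
    and com: "\<And>x. x \<in> X \<Longrightarrow> f (shift x) = shift (f x)"
    by (auto simp: shift_auts_def)
  have bb: "bij_betw f X X" using bij by (simp add: Bij_def)
  let ?g = "\<lambda>x\<in>X. inv_into X f x"
  obtain g where g: "homeomorphic_maps (top_of_set X) (top_of_set X) f g"
    using hom homeomorphic_map_maps by blast
  have "g y = ?g y" if "y \<in> X" for y
  proof -
    have "g y \<in> X" "f (g y) = y" using g that
      by (auto simp: homeomorphic_maps_def continuous_map_def Pi_iff)
    then show ?thesis using that bb bij_betw_inv_into_left by fastforce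
  qed
  then have "homeomorphic_map (top_of_set X) (top_of_set X) ?g"
    using g homeomorphic_map_maps homeomorphic_maps_sym homeomorphic_map_eq
    by (metis (no_types, lifting) topspace_euclidean_subtopology)
  moreover have "?g (shift y) = shift (?g y)" if "y \<in> X" for y
  proof -
    have *: "?g y \<in> X" "f (?g y) = y"
      using that bb by (auto simp: bij_betw_def f_inv_into_f inv_into_into)
    then have "f (shift (?g y)) = shift y" "shift (?g y) \<in> X" "shift y \<in> X"
      using com[OF *(1)] assms that by auto
    then show ?thesis using bb bij_betw_inv_into_left by fastforce
  qed
  moreover have "?g \<in> Bij X" using bij by (rule restrict_inv_into_Bij)
  ultimately show "inv\<^bsub>BijGroup X\<^esub> f \<in> shift_auts X"
    using inv_BijGroup[OF bij] by (simp add: shift_auts_def)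
next
  fix f g assume f: "f \<in> shift_auts X" and g: "g \<in> shift_auts X"
  then have fg: "f \<in> Bij X" "g \<in> Bij X" by (auto simp: shift_auts_def)
  have gX: "g x \<in> X" if "x \<in> X" for x
    using fg that by (auto simp: Bij_def bij_betw_def)
  have "homeomorphic_map (top_of_set X) (top_of_set X) (f \<circ> g)"
    using f g homeomorphic_map_compose by (auto simp: shift_auts_def)
  then have "homeomorphic_map (top_of_set X) (top_of_set X) (compose X f g)"
    by (rule homeomorphic_map_eq) (auto simp: compose_def)
  moreover have "compose X f g (shift x) = shift (compose X f g x)" if "x \<in> X" for x
    using f g that gX assms by (auto simp: shift_auts_def compose_def)
  ultimately have "compose X f g \<in> shift_auts X"
    using fg compose_Bij by (auto simp: shift_auts_def)
  then show "f \<otimes>\<^bsub>BijGroup X\<^esub> g \<in> shift_auts X"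
    using fg by (simp add: BijGroup_def)
qed

lemma group_Aut: "subshift X \<Longrightarrow> group (Aut X)"
  unfolding Aut_def subshift_def
  by (intro subgroup.subgroup_is_group subgroup_shift_auts group_BijGroup) auto

lemma mult_Aut:
  "f \<in> carrier (Aut X) \<Longrightarrow> g \<in> carrier (Aut X) \<Longrightarrow> f \<otimes>\<^bsub>Aut X\<^esub> g = compose X f g"
  by (auto simp: Aut_def BijGroup_def shift_auts_def)

lemma one_Aut: "\<one>\<^bsub>Aut X\<^esub> = (\<lambda>x\<in>X. x)"
  by (simp add: Aut_def BijGroup_def)

lemma continuous_on_translate: "continuous_on X (\<lambda>x :: int \<Rightarrow> bool. \<lambda>n. x (n + k))"
proof (rule continuous_on_coordinatewise_then_product)
  show "continuous_on X (\<lambda>x :: int \<Rightarrow> bool. x (n + k))" for n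
    by (rule continuous_on_subset[OF continuous_on_product_coordinates subset_UNIV])
qed

lemma shift_in_Aut:
  assumes "subshift X"
  shows "restrict shift X \<in> carrier (Aut X)"
proof -
  have im: "shift ` X = X" using assms by (simp add: subshift_def)
  have mem: "(\<lambda>n. x (n - 1)) \<in> X" if "x \<in> X" for x
  proof -
    have "x \<in> shift ` X" unfolding im by (rule that)
    then obtain y where "x = shift y" "y \<in> X" by (rule imageE)
    then show ?thesis by (simp add: shift_def)
  qed
  have "homeomorphic_maps (top_of_set X) (top_of_set X) shift (\<lambda>x n. x (n - 1))"
    unfolding homeomorphic_maps_def
  proof (intro conjI ballI)
    have "continuous_on X shift"
      unfolding shift_def[abs_def] by (rule continuous_on_translate)
    then show "continuous_map (top_of_set X) (top_of_set X) shift"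
      using im by auto
    have "continuous_on X (\<lambda>x n. x (n - 1))"
      using continuous_on_translate[of X "-1"] by simp
    then show "continuous_map (top_of_set X) (top_of_set X) (\<lambda>x n. x (n - 1))"
      using mem by auto
  qed (simp_all add: shift_def)
  then have "homeomorphic_map (top_of_set X) (top_of_set X) shift"
    using homeomorphic_map_maps by blast
  then have "homeomorphic_map (top_of_set X) (top_of_set X) (restrict shift X)"
    by (rule homeomorphic_map_eq) auto
  moreover have "restrict shift X \<in> Bij X"
    using im inj_shift by (auto simp: Bij_def bij_betw_def inj_on_def)
  ultimately show ?thesis
    using im by (auto simp: Aut_def shift_auts_def)
qed

lemma shift_pow_nat_Aut:
  assumes "subshift X"
  shows "restrict shift X [^]\<^bsub>Aut X\<^esub> (k::nat) = (\<lambda>x\<in>X. \<lambda>m. x (m + int k))"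
proof (induction k)
  case 0
  show ?case by (simp add: one_Aut)
next
  case (Suc k)
  interpret group "Aut X" by (rule group_Aut[OF assms])
  have "restrict shift X [^]\<^bsub>Aut X\<^esub> Suc k =
      compose X (restrict shift X [^]\<^bsub>Aut X\<^esub> k) (restrict shift X)"
    using mult_Aut[OF nat_pow_closed shift_in_Aut, OF shift_in_Aut, OF assms assms] by simp
  also have "\<dots> = compose X (\<lambda>x\<in>X. \<lambda>m. x (m + int k)) (restrict shift X)"
    by (simp only: Suc)
  also have "\<dots> = (\<lambda>x\<in>X. \<lambda>m. x (m + int (Suc k)))"
  proof -
    have "shift x \<in> X" if "x \<in> X" for x
      using assms that by (auto simp: subshift_def)
    then show ?thesis
      unfolding compose_def by (intro restrict_ext ext) (simp add: shift_def ac_simps)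
  qed
  finally show ?case .
qed

lemma Aut_carrierD:
  assumes "f \<in> carrier (Aut X)"
  shows "f \<in> extensional X" and "x \<in> X \<Longrightarrow> f x \<in> X"
  using assms by (auto simp: Aut_def shift_auts_def Bij_def bij_betw_def)

lemma shift_pow_int_Aut:
  assumes "subshift X"
  shows "restrict shift X [^]\<^bsub>Aut X\<^esub> (n::int) = (\<lambda>x\<in>X. \<lambda>m. x (m + n))"
proof (cases n)
  case (nonneg k)
  show ?thesis
    unfolding nonneg int_pow_int by (rule shift_pow_nat_Aut[OF assms])
next
  case (neg k)
  interpret group "Aut X" by (rule group_Aut[OF assms])
  define j where "j = Suc k"
  define f where "f = restrict shift X [^]\<^bsub>Aut X\<^esub> j"
  have n: "n = - int j" using neg by (simp add: j_def)
  have f: "f \<in> carrier (Aut X)"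
    unfolding f_def by (rule nat_pow_closed[OF shift_in_Aut[OF assms]])
  have f_apply: "f x = (\<lambda>m. x (m + int j))" if "x \<in> X" for x
    unfolding f_def shift_pow_nat_Aut[OF assms] by (rule restrict_apply'[OF that])
  define g where "g = inv\<^bsub>Aut X\<^esub> f"
  have g: "g \<in> carrier (Aut X)" unfolding g_def by (rule inv_closed[OF f])
  have comp: "compose X f g = (\<lambda>x\<in>X. x)"
    using mult_Aut[OF f g] r_inv[OF f] one_Aut[of X] by (simp only: g_def)
  have id: "f (g x) = x" if "x \<in> X" for x
    using fun_cong[OF comp, of x] by (simp only: compose_eq[OF that] restrict_apply'[OF that])
  have "g = (\<lambda>x\<in>X. \<lambda>m. x (m + n))"
  proof (rule extensionalityI[OF Aut_carrierD(1)[OF g] restrict_extensional])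
    fix x assume x: "x \<in> X"
    have *: "(\<lambda>m. g x (m + int j)) = x"
      using id[OF x] f_apply[OF Aut_carrierD(2)[OF g x]] by (simp only:)
    have "g x m = x (m + n)" for m
      using fun_cong[OF *, of "m + n"] n by simp
    then show "g x = (\<lambda>x\<in>X. \<lambda>m. x (m + n)) x"
      using x by (simp only: restrict_apply') blast
  qed
  moreover have "restrict shift X [^]\<^bsub>Aut X\<^esub> n = g"
    unfolding n g_def f_def by (rule int_pow_neg_int[OF shift_in_Aut[OF assms]])
  ultimately show ?thesis by (simp only:)
qed

end

theory Submission
  imports Defs
begin

text \<open>
  \<^bold>\<open>Embedding gives a nontrivial automorphism.\<close>
  The group of the full shift contains an involution, the exchange of the two symbols, whereas
  the powers of \<open>\<sigma>\<close> on the admissible shift form a torsion-free group, because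
  \<open>\<sigma>\<close> moves the point with a single \<open>1\<close> without ever returning it
  (\<open>non_shift_power_if_embeds\<close>).

  \<^bold>\<open>Without a set \<open>K\<close> as in (c) there are only shifts.\<close>
  If no finite minimal union of residue classes has an admissible complement, then a finite
  admissible set \<open>C\<close> never forces a further point: for every \<open>c \<notin> C\<close> one can enlarge
  \<open>C\<close> within the admissible sets to a \<open>D\<close> to which \<open>c\<close> cannot be added
  (\<open>admissible_extension_excluding\<close>). On the other hand an automorphism is a block code, which
  acts independently on pieces that lie far apart, and moving pieces apart by multiples of a large
  factorial does not change the residues that decide whether a finite set is admissible. So if
  \<open>C \<union> D\<close> is admissible, it remains so after \<open>C\<close> alone has been replaced by its
  image and every point of \<open>D\<close> by the image of that point (\<open>admissible_code_union\<close>).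
  A code that is not a translation would create a point \<open>c\<close> outside the translate of
  \<open>C\<close>, or destroy one, and thereby turn \<open>C\<close> or its image into a set that forces a
  further point (\<open>invertible_code_is_translation\<close>).

  \<^bold>\<open>A set \<open>K\<close> as in (c) gives room for the whole group of the full shift.\<close>
  Let \<open>M\<close> be the complement of \<open>K\<close>, a periodic set. By minimality of \<open>K\<close>, a point
  that shows the complete pattern of a translate of \<open>M\<close> on one period is supported in that
  translate (\<open>support_in_frame\<close>), and all subsets of a translate of \<open>M\<close> are
  admissible. Hence cells that start with the pattern of \<open>M\<close> and then carry two free bits
  can be read off without ambiguity, and their bits can be rewritten at will. The bits of a maximal
  chain of adjacent cells are arranged as a conveyor belt: the first bits are read from left to
  right, the second ones from right to left, and the belt turns round at the ends of the chain. In
  this way each bit sees a two-sided sequence, on which an automorphism of the full shift acts.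
  As it commutes with the shift, it does not matter where the reading starts, so the rewriting of
  cells is a group action, and the existence of two-sided infinite chains makes it faithful
  (\<open>act_monomorphism\<close>).
\<close>

section \<open>Automorphisms of subshifts\<close>

definition translate :: "int \<Rightarrow> (int \<Rightarrow> bool) \<Rightarrow> (int \<Rightarrow> bool)" where
  "translate k x = (\<lambda>n. x (n + k))"

lemma translate_apply: "translate k x n = x (n + k)"
  by (simp add: translate_def)

lemma translate_translate [simp]: "translate k (translate l x) = translate (k + l) x"
  by (simp add: translate_def ac_simps)

lemma translate_0 [simp]: "translate 0 x = x"
  by (simp add: translate_def)

lemma shift_eq_translate: "shift = translate 1"
  by (simp add: fun_eq_iff shift_def translate_apply)

lemma translate_mem_iff:
  assumes "\<And>x. shift x \<in> X \<longleftrightarrow> x \<in> X"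
  shows "translate k x \<in> X \<longleftrightarrow> x \<in> X"
proof -
  have step: "translate (i + 1) x \<in> X \<longleftrightarrow> translate i x \<in> X" for i
    using assms[of "translate i x"] by (simp add: shift_eq_translate add.commute)
  show ?thesis
  proof (induction k rule: int_induct[where k = 0])
    case (step2 i)
    then show ?case using step[of "i - 1"] by simp
  qed (use step in simp_all)
qed

lemma commute_translate:
  assumes "\<And>x. shift x \<in> X \<longleftrightarrow> x \<in> X" and "\<And>x. x \<in> X \<Longrightarrow> f (shift x) = shift (f x)" and "x \<in> X"
  shows "f (translate k x) = translate k (f x)"
proof -
  have step: "f (translate (i + 1) x) = shift (f (translate i x))" for i
    using assms(2)[of "translate i x"] translate_mem_iff[OF assms(1)] assms(3)
    by (simp add: shift_eq_translate add.commute)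
  show ?thesis
  proof (induction k rule: int_induct[where k = 0])
    case (step1 i)
    then show ?case using step[of i] by (simp add: shift_eq_translate add.commute)
  next
    case (step2 i)
    then have "shift (f (translate (i - 1) x)) = shift (translate (i - 1) (f x))"
      using step[of "i - 1"] by (simp add: shift_eq_translate)
    then show ?case using inj_shift by (auto dest: injD)
  qed simp
qed

lemma shift_mem_subshift_iff: "subshift X \<Longrightarrow> shift x \<in> X \<longleftrightarrow> x \<in> X"
  using inj_shift unfolding subshift_def by (metis image_iff injD)

lemma carrier_AutI:
  assumes "f \<in> extensional X" and "f \<in> X \<rightarrow> X" and "g \<in> X \<rightarrow> X"
    and "\<And>x. x \<in> X \<Longrightarrow> g (f x) = x" and "\<And>x. x \<in> X \<Longrightarrow> f (g x) = x"
    and "continuous_on X f" and "continuous_on X g"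
    and "\<And>x. x \<in> X \<Longrightarrow> f (shift x) = shift (f x)"
  shows "f \<in> carrier (Aut X)"
proof -
  have "homeomorphic_maps (top_of_set X) (top_of_set X) f g"
    using assms by (auto simp: homeomorphic_maps_def)
  moreover have "bij_betw f X X"
    using assms by (intro bij_betwI[where g = g]) auto
  ultimately show ?thesis
    using assms by (auto simp: Aut_def shift_auts_def Bij_def homeomorphic_map_maps)
qed

lemma carrier_Aut_continuous_on:
  assumes "f \<in> carrier (Aut X)" shows "continuous_on X f"
  using assms homeomorphic_imp_continuous_map[of "top_of_set X" "top_of_set X" f]
  by (auto simp: Aut_def shift_auts_def)

lemma carrier_Aut_translate:
  assumes "subshift X" and "f \<in> carrier (Aut X)" and "x \<in> X"
  shows "f (translate k x) = translate k (f x)"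
  using assms commute_translate[OF shift_mem_subshift_iff[OF assms(1)]]
  by (auto simp: Aut_def shift_auts_def)

lemma carrier_Aut_inverse:
  assumes "subshift X" and "f \<in> carrier (Aut X)"
  obtains g where "g \<in> carrier (Aut X)" "\<And>x. x \<in> X \<Longrightarrow> f (g x) = x" "\<And>x. x \<in> X \<Longrightarrow> g (f x) = x"
proof -
  interpret group "Aut X" by (rule group_Aut[OF assms(1)])
  let ?g = "inv\<^bsub>Aut X\<^esub> f"
  have g: "?g \<in> carrier (Aut X)" using assms(2) by (rule inv_closed)
  have "compose X f ?g = (\<lambda>x\<in>X. x)" "compose X ?g f = (\<lambda>x\<in>X. x)"
    using mult_Aut[OF assms(2) g] mult_Aut[OF g assms(2)] r_inv[OF assms(2)] l_inv[OF assms(2)]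
    by (simp_all only: one_Aut)
  then have "f (?g x) = x" "?g (f x) = x" if "x \<in> X" for x
    using that by (metis compose_eq restrict_apply')+
  then show ?thesis using that g by blast
qed

section \<open>Continuity and block codes\<close>

text \<open>
  The cylinders form a neighbourhood base of the product topology; this turns questions about
  continuity of \<open>bool\<close>-valued maps into questions about finitely many coordinates.
\<close>
lemma eventually_nhds_agree_iff:
  fixes x :: "int \<Rightarrow> bool"
  shows "(\<forall>\<^sub>F y in nhds x. P y) \<longleftrightarrow> (\<exists>J. finite J \<and> (\<forall>y. (\<forall>j\<in>J. y j = x j) \<longrightarrow> P y))"
proof
  assume "\<forall>\<^sub>F y in nhds x. P y"
  then obtain U where U: "open U" "x \<in> U" "\<And>y. y \<in> U \<Longrightarrow> P y"
    unfolding eventually_nhds by blast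
  have "openin (product_topology (\<lambda>i. euclidean) UNIV) U"
    using U(1) by (simp add: open_fun_def)
  from product_topology_open_contains_basis[OF this U(2)]
  obtain V where V: "x \<in> (\<Pi>\<^sub>E i\<in>UNIV. V i)" "finite {i. V i \<noteq> UNIV}" "(\<Pi>\<^sub>E i\<in>UNIV. V i) \<subseteq> U"
    by auto
  have "P y" if "\<forall>j\<in>{i. V i \<noteq> UNIV}. y j = x j" for y
  proof -
    have "y i \<in> V i" for i
      using V(1) that by (cases "V i = UNIV") (auto simp: PiE_iff)
    then show ?thesis using V(3) U(3) by (auto simp: PiE_iff)
  qed
  then show "\<exists>J. finite J \<and> (\<forall>y. (\<forall>j\<in>J. y j = x j) \<longrightarrow> P y)" using V(2) by blast
next
  assume "\<exists>J. finite J \<and> (\<forall>y. (\<forall>j\<in>J. y j = x j) \<longrightarrow> P y)"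
  then obtain J where J: "finite J" "\<And>y. (\<forall>j\<in>J. y j = x j) \<Longrightarrow> P y" by blast
  have "\<forall>\<^sub>F y in nhds x. y j = x j" for j
  proof -
    have "continuous_on UNIV (\<lambda>y :: int \<Rightarrow> bool. y j)"
      by (rule continuous_on_product_coordinates)
    then have "((\<lambda>y :: int \<Rightarrow> bool. y j) \<longlongrightarrow> x j) (at x)"
      by (simp add: continuous_on_def)
    then have "((\<lambda>y :: int \<Rightarrow> bool. y j) \<longlongrightarrow> x j) (nhds x)"
      using tendsto_at_iff_tendsto_nhds[of "\<lambda>y :: int \<Rightarrow> bool. y j" x] by blast
    then show ?thesis by (simp add: tendsto_discrete)
  qed
  then have "\<forall>\<^sub>F y in nhds x. \<forall>j\<in>J. y j = x j"
    using J(1) by (simp add: eventually_ball_finite)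
  then show "\<forall>\<^sub>F y in nhds x. P y" by (rule eventually_mono) (rule J(2))
qed

lemma continuous_on_UNIV_discrete_iff:
  fixes h :: "'a::topological_space \<Rightarrow> 'b::discrete_topology"
  shows "continuous_on UNIV h \<longleftrightarrow> (\<forall>x. \<forall>\<^sub>F y in nhds x. h y = h x)"
proof -
  have "(\<forall>\<^sub>F y in at x. h y = h x) \<longleftrightarrow> (\<forall>\<^sub>F y in nhds x. h y = h x)" for x
    unfolding eventually_at_filter by (intro eventually_subst always_eventually) auto
  then show ?thesis by (simp add: continuous_on_def tendsto_discrete)
qed

lemma compact_full_shift: "compact (UNIV :: (int \<Rightarrow> bool) set)"
proof -
  have "compact_space (euclidean :: bool topology)"
    by (simp add: compact_space_def finite_imp_compact)
  then have "compact_space (product_topology (\<lambda>i :: int. euclidean :: bool topology) UNIV)"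
    by (simp add: compact_space_product_topology)
  then have "compact_space (euclidean :: (int \<Rightarrow> bool) topology)"
    by (simp only: euclidean_product_topology)
  then show ?thesis by (simp add: compact_space_def)
qed

text \<open>
  The Curtis--Hedlund--Lyndon principle: \<open>h\<close> is locally constant, and by compactness
  finitely many cylinders on which it is constant cover \<open>X\<close>.
\<close>
lemma continuous_on_imp_block_code:
  fixes X :: "(int \<Rightarrow> bool) set" and h :: "(int \<Rightarrow> bool) \<Rightarrow> bool"
  assumes "closed X" and "continuous_on X h"
  obtains R where "\<And>x y. \<lbrakk>x \<in> X; y \<in> X; \<forall>i\<in>{-R..R}. x i = y i\<rbrakk> \<Longrightarrow> h x = h y"
proof -
  have "\<exists>J. finite J \<and> (\<forall>y\<in>X. (\<forall>j\<in>J. y j = x j) \<longrightarrow> h y = h x)" if "x \<in> X" for x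
  proof -
    have "\<forall>\<^sub>F y in at x within X. h y = h x"
      using assms(2) that by (simp add: continuous_on_def tendsto_discrete)
    then have "\<forall>\<^sub>F y in nhds x. y \<in> X \<longrightarrow> h y = h x"
      by (auto simp: eventually_at_filter elim!: eventually_mono)
    then show ?thesis unfolding eventually_nhds_agree_iff by blast
  qed
  then obtain J where J: "\<And>x. x \<in> X \<Longrightarrow> finite (J x)"
    "\<And>x y. \<lbrakk>x \<in> X; y \<in> X; \<forall>j\<in>J x. y j = x j\<rbrakk> \<Longrightarrow> h y = h x" by metis
  define U where "U x = {y. \<forall>j\<in>J x. y j = x j}" for x
  have U_open: "open (U x)" if "x \<in> X" for x
    unfolding open_subopen[of "U x"]
  proof
    fix y assume "y \<in> U x"
    then have "\<forall>\<^sub>F z in nhds y. z \<in> U x"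
      unfolding eventually_nhds_agree_iff using J(1)[OF that] by (auto simp: U_def)
    then show "\<exists>T. open T \<and> y \<in> T \<and> T \<subseteq> U x" by (auto simp: eventually_nhds)
  qed
  have "compact X"
    using compact_Int_closed[OF compact_full_shift assms(1)] by simp
  moreover have "X \<subseteq> (\<Union>x\<in>X. U x)" by (auto simp: U_def)
  ultimately obtain F where F: "F \<subseteq> X" "finite F" "X \<subseteq> (\<Union>x\<in>F. U x)"
    using compactE_image[of X X U thesis] U_open by simp
  have "finite (\<Union>x\<in>F. J x)" using F J(1) by (intro finite_UN_I) auto
  then have "finite (abs ` (\<Union>x\<in>F. J x))" by (rule finite_imageI)
  define R where "R = Max (abs ` (\<Union>x\<in>F. J x))"
  have R: "\<bar>j\<bar> \<le> R" if "j \<in> (\<Union>x\<in>F. J x)" for j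
    unfolding R_def using \<open>finite (abs ` _)\<close> that by (intro Max_ge imageI)
  show ?thesis
  proof (rule that)
    fix x y assume xy: "x \<in> X" "y \<in> X" "\<forall>i\<in>{-R..R}. x i = y i"
    obtain z where z: "z \<in> F" "x \<in> U z" using F(3) xy(1) by blast
    have x: "x j = z j" if "j \<in> J z" for j
      using z(2) that by (simp add: U_def)
    moreover have "y j = z j" if "j \<in> J z" for j
    proof -
      have "\<bar>j\<bar> \<le> R" using R[of j] z(1) that by blast
      then have "j \<in> {-R..R}" by auto
      then show ?thesis using x[OF that] xy(3) by simp
    qed
    ultimately show "h x = h y" using J(2)[of z x] J(2)[of z y] z(1) F(1) xy by blast
  qed
qed

section \<open>Admissible sets and unions of residue classes\<close>

lemma mem_residue_union: "n \<in> residue_union S r \<longleftrightarrow> (\<exists>b\<in>S. [n = r b] (mod int b))"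
proof -
  have "n = a + c * k \<longleftrightarrow> n - a = c * k" for a c k :: int by linarith
  then show ?thesis
    by (simp only: residue_union_def UN_iff image_iff cong_iff_dvd_diff dvd_def) simp
qed

lemma admissible_iff_avoids_residue_union:
  assumes "\<forall>b\<in>B. b > 0"
  shows "admissible B A \<longleftrightarrow> (\<exists>r. A \<inter> residue_union B r = {})"
proof -
  have "admissible B A \<longleftrightarrow> (\<exists>r. \<forall>b\<in>B. \<forall>n\<in>A. \<not> [n = r b] (mod int b))"
    unfolding admissible_iff_misses_residue[OF assms] by (rule bchoice_iff)
  then show ?thesis by (auto simp: mem_residue_union disjoint_iff)
qed

lemma admissible_mono:
  assumes "\<forall>b\<in>B. b > 0" and "admissible B A" and "C \<subseteq> A"
  shows "admissible B C"
  using assms(2,3) unfolding admissible_iff_avoids_residue_union[OF assms(1)] by blast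


lemma admissible_translate:
  assumes "\<forall>b\<in>B. b > 0"
  shows "admissible B ((+) k ` A) \<longleftrightarrow> admissible B A"
proof -
  have "{n. translate (- k) (\<lambda>n. n \<in> A) n} = (+) k ` A"
  proof (rule Set.set_eqI)
    fix n
    have "n \<in> (+) k ` A \<longleftrightarrow> n - k \<in> A" by (force simp: image_iff)
    then show "n \<in> {n. translate (- k) (\<lambda>n. n \<in> A) n} \<longleftrightarrow> n \<in> (+) k ` A"
      by (simp add: translate_apply)
  qed
  then show ?thesis
    using translate_mem_iff[OF shift_mem_admissible_shift[OF assms], of "- k" "\<lambda>n. n \<in> A"]
    by (simp add: admissible_shift_def)
qed

text \<open>
  A finite set cannot fill the residues modulo any \<open>b > card A\<close>, so only finitely many
  moduli have to be checked, and for those only the set of residues matters.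
\<close>
lemma admissible_finiteI:
  assumes "finite A" and "admissible B A'"
    and "\<And>b. \<lbrakk>b \<in> B; b \<le> card A\<rbrakk> \<Longrightarrow> (\<lambda>n. n mod int b) ` A \<subseteq> (\<lambda>n. n mod int b) ` A'"
    and "\<forall>b\<in>B. b > 0"
  shows "admissible B A"
  unfolding admissible_def
proof
  fix b assume b: "b \<in> B"
  show "card ((\<lambda>n. n mod int b) ` A) < b"
  proof (cases "b \<le> card A")
    case True
    have "(\<lambda>n. n mod int b) ` A' \<subseteq> {0..<int b}" using assms(4) b by auto
    then have "finite ((\<lambda>n. n mod int b) ` A')" by (rule finite_subset) simp
    then have "card ((\<lambda>n. n mod int b) ` A) \<le> card ((\<lambda>n. n mod int b) ` A')"
      using assms(3)[OF b True] by (rule card_mono)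
    also have "\<dots> < b" using assms(2) b by (simp add: admissible_def)
    finally show ?thesis .
  next
    case False
    then show ?thesis using card_image_le[OF assms(1), of "\<lambda>n. n mod int b"] by simp
  qed
qed

lemma admissible_singleton:
  assumes "B \<subseteq> {2..}" shows "admissible B {n}"
  using assms by (auto simp: admissible_def)

lemma not_admissible_UNIV:
  assumes "\<forall>b\<in>B. b > 0" and "B \<noteq> {}" shows "\<not> admissible B UNIV"
  using assms(2) by (auto simp: admissible_iff_misses_residue[OF assms(1)] intro: cong_refl)

section \<open>Extensions that exclude a point\<close>

text \<open>
  The union depends only on the residues \<open>r b mod b\<close>, so for fixed \<open>S\<close> there are only
  finitely many unions.
\<close>
lemma minimal_residue_union_below:
  assumes "finite S" and "\<forall>b\<in>S. b > 0"
  obtains r where "residue_union S r \<subseteq> residue_union S r0"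
    "\<forall>r'. residue_union S r' \<subseteq> residue_union S r \<longrightarrow> residue_union S r' = residue_union S r"
proof -
  have "range (residue_union S) \<subseteq> residue_union S ` (\<Pi>\<^sub>E b\<in>S. {0..<int b})"
  proof
    fix K assume "K \<in> range (residue_union S)"
    then obtain r where "K = residue_union S r" by blast
    also have "\<dots> = residue_union S (\<lambda>b\<in>S. r b mod int b)"
      by (auto simp: mem_residue_union cong_def)
    finally show "K \<in> residue_union S ` (\<Pi>\<^sub>E b\<in>S. {0..<int b})"
      using assms(2) by (auto intro!: imageI)
  qed
  then have "finite (range (residue_union S))"
    by (rule finite_subset) (intro finite_imageI finite_PiE assms(1), simp)
  from finite_has_minimal2[OF this, of "residue_union S r0"] show ?thesis
    using that by auto blast
qed

text \<open>
  Let \<open>S\<close> consist of the moduli that identify two points of \<open>insert c C\<close>, and choose a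
  minimal \<open>K = residue_union S r\<close> that avoids \<open>C\<close>. As \<open>- K\<close> is not admissible,
  there is a least \<open>b \<in> B\<close> such that \<open>- K\<close> meets all classes modulo \<open>b\<close>. It
  is not in \<open>S\<close>, since \<open>K\<close> contains a class for each modulus in \<open>S\<close>, so the points
  of \<open>insert c C\<close> are distinct modulo \<open>b\<close>. Add to \<open>C\<close> one point of \<open>- K\<close> for
  each class modulo \<open>b\<close> other than those of \<open>c\<close> and of the points of \<open>C\<close>. The
  result \<open>D\<close> is a set of \<open>b - 1\<close> points: moduli below \<open>b\<close> are harmless because
  \<open>D \<subseteq> - K\<close> and \<open>b\<close> is least, the other ones because \<open>D\<close> is too small, while
  \<open>c\<close> would complete the residues modulo \<open>b\<close>.
\<close>
lemma admissible_extension_excluding: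
  assumes B: "\<forall>b\<in>B. b > 0"
    and no_K: "\<And>S r. \<lbrakk>finite S; S \<subseteq> B;
        \<forall>r'. residue_union S r' \<subseteq> residue_union S r \<longrightarrow> residue_union S r' = residue_union S r\<rbrakk>
        \<Longrightarrow> \<not> admissible B (- residue_union S r)"
    and C: "finite C" "admissible B C" and c: "c \<notin> C"
  shows "\<exists>D. finite D \<and> C \<subseteq> D \<and> admissible B D \<and> \<not> admissible B (insert c D)"
proof -
  define F where "F = insert c C"
  define S where "S = {b\<in>B. \<not> inj_on (\<lambda>n. n mod int b) F}"
  have fin_F: "finite F" using C(1) by (simp add: F_def)
  have "S \<subseteq> (\<Union>(x, y)\<in>F \<times> F - Id. {b. b dvd nat \<bar>x - y\<bar>})"
    by (auto simp: S_def inj_on_def mod_eq_dvd_iff)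
  moreover have "finite (\<Union>(x, y)\<in>F \<times> F - Id. {b. b dvd nat \<bar>x - y\<bar>})"
  proof (intro finite_UN_I finite_Diff finite_cartesian_product fin_F)
    fix p assume "p \<in> F \<times> F - Id"
    then show "finite (case p of (x, y) \<Rightarrow> {b. b dvd nat \<bar>x - y\<bar>})"
      by (auto intro!: finite_divisors_nat simp del: dvd_nat_abs_iff)
  qed
  ultimately have fin_S: "finite S" by (rule finite_subset)
  have S_B: "S \<subseteq> B" by (auto simp: S_def)
  have pos_S: "\<forall>b\<in>S. b > 0" using B by (simp add: S_def)
  obtain r0 where r0: "C \<inter> residue_union B r0 = {}"
    using C(2) admissible_iff_avoids_residue_union[OF B] by blast
  obtain r where r: "residue_union S r \<subseteq> residue_union S r0"
    and min: "\<forall>r'. residue_union S r' \<subseteq> residue_union S r \<longrightarrow> residue_union S r' = residue_union S r"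
    using minimal_residue_union_below[OF fin_S pos_S] by blast
  define Q where "Q = - residue_union S r"
  have "residue_union S r0 \<subseteq> residue_union B r0" using S_B unfolding residue_union_def by blast
  then have CQ: "C \<subseteq> Q" using r r0 by (auto simp: Q_def)
  define full where "full b \<longleftrightarrow> b \<in> B \<and> (\<forall>s. \<exists>n\<in>Q. [n = s] (mod int b))" for b
  define b where "b = (LEAST b. full b)"
  have "\<not> admissible B Q" using no_K[OF fin_S S_B min] by (simp add: Q_def)
  then have "\<exists>b. full b"
    by (auto simp: admissible_iff_misses_residue[OF B] full_def)
  then have b: "full b" and b_least: "\<And>b'. full b' \<Longrightarrow> b \<le> b'"
    unfolding b_def by (auto intro: LeastI_ex Least_le)
  have bB: "b \<in> B" using b by (simp add: full_def)
  then have b0: "int b > 0" using B by simp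
  have hits: "\<exists>n. n \<in> Q \<and> [n = s] (mod int b)" for s using b by (auto simp: full_def)
  have "b \<notin> S" using hits[of "r b"] by (auto simp: Q_def mem_residue_union)
  then have inj: "inj_on (\<lambda>n. n mod int b) F" using bB by (simp add: S_def)
  obtain h where h: "\<And>s. h s \<in> Q" "\<And>s. [h s = s] (mod int b)"
    using choice[of "\<lambda>s n. n \<in> Q \<and> [n = s] (mod int b)"] hits by blast
  define T where "T = {0..<int b} - (\<lambda>n. n mod int b) ` F"
  define D where "D = C \<union> h ` T"
  have D_Q: "D \<subseteq> Q" using CQ h(1) by (auto simp: D_def)
  have fin_D: "finite D" using C(1) by (simp add: D_def T_def)
  have sub: "(\<lambda>n. n mod int b) ` F \<subseteq> {0..<int b}" using b0 by auto
  \<comment> \<open>\<open>C\<close> and \<open>c\<close> occupy \<open>card C + 1\<close> different residues, so fewer than \<open>b\<close> points are used.\<close>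
  have "card T = b - (card C + 1)"
    using c C(1) fin_F sub card_image[OF inj] by (simp add: T_def card_Diff_subset F_def)
  moreover have "card C + 1 \<le> b"
    using card_mono[OF _ sub] card_image[OF inj] c C(1) by (simp add: F_def)
  ultimately have card_D: "card D < b"
    using card_Un_le[of C "h ` T"] card_image_le[of T h] by (simp add: D_def T_def)
  show ?thesis
  proof (intro exI[of _ D] conjI)
    show "C \<subseteq> D" by (simp add: D_def)
    show "admissible B D"
      unfolding admissible_def
    proof
      fix b' assume b': "b' \<in> B"
      show "card ((\<lambda>n. n mod int b') ` D) < b'"
      proof (cases "b' < b")
        case True
        then have "\<not> full b'" using b_least by force
        then have "admissible {b'} D"
          using b' B D_Q by (auto simp: full_def admissible_iff_misses_residue)
        then show ?thesis by (simp add: admissible_def)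
      next
        case False
        then show ?thesis using card_D card_image_le[OF fin_D, of "\<lambda>n. n mod int b'"] by simp
      qed
    qed
    have "{0..<int b} \<subseteq> (\<lambda>n. n mod int b) ` insert c D"
    proof
      fix s assume s: "s \<in> {0..<int b}"
      show "s \<in> (\<lambda>n. n mod int b) ` insert c D"
      proof (cases "s \<in> T")
        case True
        then show ?thesis using h(2)[of s] s by (force simp: D_def cong_def)
      next
        case False
        then show ?thesis using s by (auto simp: T_def F_def D_def)
      qed
    qed
    from card_mono[OF _ this] have large: "b \<le> card ((\<lambda>n. n mod int b) ` insert c D)"
      using fin_D by simp
    show "\<not> admissible B (insert c D)"
      unfolding admissible_def using bB not_less[THEN iffD2, OF large] by blast
  qed (rule fin_D)
qed

section \<open>Rigidity of codes on admissible sets\<close>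

text \<open>
  A shift-commuting block code, described on supports instead of sequences, since the arguments
  below are about residues of sets.
\<close>
locale admissible_code =
  fixes B :: "nat set" and F :: "int set \<Rightarrow> int set" and R :: int
  assumes moduli: "B \<noteq> {}" "B \<subseteq> {2..}"
    and admissible_code: "admissible B A \<Longrightarrow> admissible B (F A)"
    and code_translate: "admissible B A \<Longrightarrow> F ((+) k ` A) = (+) k ` F A"
    and code_local: "\<lbrakk>admissible B A; admissible B A'; A \<inter> {n - R..n + R} = A' \<inter> {n - R..n + R}\<rbrakk>
      \<Longrightarrow> n \<in> F A \<longleftrightarrow> n \<in> F A'"
begin

lemma moduli_pos: "\<forall>b\<in>B. b > 0"
  using moduli(2) by auto

lemma admissible_subset: "\<lbrakk>admissible B A; C \<subseteq> A\<rbrakk> \<Longrightarrow> admissible B C"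
  by (rule admissible_mono[OF moduli_pos])

lemma admissible_empty: "admissible B {}"
  by (rule admissible_subset[OF admissible_singleton[OF moduli(2)] empty_subsetI])

lemma code_empty: "F {} = {}"
proof (rule ccontr)
  assume "F {} \<noteq> {}"
  then obtain n where n: "n \<in> F {}" by blast
  have "m \<in> F {}" for m
  proof -
    have "(+) (m - n) ` F {} = F {}"
      using code_translate[OF admissible_empty, of "m - n"] by simp
    moreover have "m \<in> (+) (m - n) ` F {}" by (rule image_eqI[OF _ n]) simp
    ultimately show ?thesis by simp
  qed
  \<comment> \<open>a translation-invariant set is empty or everything, and the latter is not admissible\<close>
  then have "F {} = UNIV" by blast
  then show False
    using admissible_code[OF admissible_empty] not_admissible_UNIV[OF moduli_pos moduli(1)] by simp
qed

lemma code_near: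
  assumes "admissible B A" and "n \<in> F A"
  obtains a where "a \<in> A" "a \<in> {n - R..n + R}"
proof -
  have "A \<inter> {n - R..n + R} \<noteq> {}"
    using code_local[OF assms(1) admissible_empty, of n] assms(2) code_empty by auto
  then show ?thesis using that by blast
qed

lemma finite_code:
  assumes "finite A" and "admissible B A" shows "finite (F A)"
proof (rule finite_subset)
  show "F A \<subseteq> (\<Union>a\<in>A. {a - R..a + R})"
  proof
    fix n assume "n \<in> F A"
    then obtain a where "a \<in> A" "a \<in> {n - R..n + R}" by (rule code_near[OF assms(2)])
    then show "n \<in> (\<Union>a\<in>A. {a - R..a + R})" by (intro UN_I[of a]) auto
  qed
qed (use assms(1) in simp)

text \<open>
  Move every \<open>d \<in> D\<close> to \<open>h d\<close> by a multiple of \<open>M = k!\<close>, so far that the pieces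
  \<open>C\<close> and \<open>{h d}\<close> are further apart than the window of the code. The set \<open>E\<close> so
  obtained has the same residues as \<open>C \<union> D\<close> for all moduli up to \<open>k\<close>, so it is
  admissible, hence \<open>F E\<close> is, and \<open>F E\<close> contains the image of each piece. Moving the
  images of the points back again does not change residues for the moduli up to \<open>k\<close> either.
\<close>
lemma admissible_code_union:
  assumes "finite C" and "finite D" and CD: "admissible B (C \<union> D)"
  shows "admissible B (F C \<union> (\<Union>d\<in>D. (+) d ` F {0}))"
proof -
  define W where "W = F C \<union> (\<Union>d\<in>D. (+) d ` F {0})"
  define k where "k = max (card C + card D) (card W)"
  define M :: int where "M = fact k"
  have C: "admissible B C" using CD by (rule admissible_subset) simp
  have zero: "admissible B {0}" by (rule admissible_singleton[OF moduli(2)])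
  have fin_W: "finite W"
    using assms(1,2) finite_code[OF _ C] finite_code[OF _ zero] by (simp add: W_def)
  obtain q where q: "\<bar>c\<bar> \<le> q" if "c \<in> C \<union> D" for c
    using finite_imageI[of "C \<union> D" abs] assms(1,2) Max_ge[of "abs ` (C \<union> D)"]
    by (metis finite_UnI imageI)
  \<comment> \<open>a shift by \<open>T\<close> carries points of \<open>D\<close> beyond \<open>C\<close> by more than \<open>2 * R\<close>\<close>
  define T where "T = 2 * \<bar>R\<bar> + 2 * \<bar>q\<bar> + 1"
  have M: "M \<ge> 1" by (simp add: M_def fact_ge_1)
  have T: "T \<ge> 1" by (simp add: T_def)
  have MT: "M * T \<ge> T" using mult_right_mono[OF M, of T] T by simp
  \<comment> \<open>the factor \<open>d + q + 1 \<ge> 1\<close> depends on \<open>d\<close>, which separates the points from each other\<close>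
  define h where "h d = d + M * T * (d + q + 1)" for d
  have h_far_C: "h d - c > 2 * R" if "d \<in> D" "c \<in> C" for c d
  proof -
    have "d + q + 1 \<ge> 1" using q[of d] that by simp
    then have "M * T * (d + q + 1) \<ge> M * T * 1"
      using MT T by (intro mult_left_mono) auto
    then have "h d \<ge> d + T" using MT by (simp add: h_def)
    then show ?thesis using q[of c] q[of d] that by (simp add: T_def)
  qed
  have h_far: "\<bar>h d - h d'\<bar> > 2 * R" if "d \<noteq> d'" for d d'
  proof -
    have "h d - h d' = (1 + M * T) * (d - d')" by (simp add: h_def algebra_simps)
    then have *: "\<bar>h d - h d'\<bar> = (1 + M * T) * \<bar>d - d'\<bar>" using MT T by (simp add: abs_mult)
    have "1 + T \<le> (1 + M * T) * 1" using MT by simp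
    also have "\<dots> \<le> (1 + M * T) * \<bar>d - d'\<bar>"
      using MT T that by (intro mult_left_mono) auto
    finally have "1 + T \<le> \<bar>h d - h d'\<bar>" unfolding * .
    then show ?thesis by (simp add: T_def)
  qed
  have h_mod: "(h d + g) mod int b = (d + g) mod int b" if "b \<in> B" "b \<le> k" for b d g
  proof -
    have "int b dvd M"
      using that moduli_pos unfolding M_def by (metis dvd_fact int_dvd_int_iff of_nat_fact Suc_le_eq One_nat_def)
    then have "int b dvd (h d + g) - (d + g)" by (simp add: h_def)
    then show ?thesis by (simp add: mod_eq_dvd_iff)
  qed
  define E where "E = C \<union> h ` D"
  have "card E \<le> card C + card D"
    using card_Un_le[of C "h ` D"] card_image_le[OF assms(2), of h] by (simp add: E_def)
  then have "card E \<le> k" by (simp add: k_def)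
  then have E: "admissible B E"
    using assms(1,2) h_mod[of _ _ 0] moduli_pos
    by (intro admissible_finiteI[OF _ CD]) (auto simp: E_def image_iff)
  have sub: "F C \<union> (\<Union>d\<in>D. (+) (h d) ` F {0}) \<subseteq> F E"
  proof (intro Un_least UN_least subsetI)
    fix n assume n: "n \<in> F C"
    then obtain c where c: "c \<in> C" "c \<in> {n - R..n + R}" by (rule code_near[OF C])
    have "h d \<notin> {n - R..n + R}" if "d \<in> D" for d
      using h_far_C[OF that c(1)] c(2) by auto
    then have "E \<inter> {n - R..n + R} = C \<inter> {n - R..n + R}" by (auto simp: E_def)
    then show "n \<in> F E" using code_local[OF E C] n by blast
  next
    fix d n assume d: "d \<in> D" and "n \<in> (+) (h d) ` F {0}"
    then have n: "n \<in> F {h d}" using code_translate[OF zero, of "h d"] by simp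
    have hd: "admissible B {h d}" by (rule admissible_singleton[OF moduli(2)])
    have near: "h d \<in> {n - R..n + R}" using code_near[OF hd n] by blast
    have "c \<notin> {n - R..n + R}" if "c \<in> C" for c
      using h_far_C[OF d that] near by auto
    moreover have "d' = d" if "h d' \<in> {n - R..n + R}" for d'
      using h_far[of d' d] near that by (cases "d' = d") auto
    ultimately have "E \<inter> {n - R..n + R} = {h d} \<inter> {n - R..n + R}"
      unfolding E_def using d near by blast
    then show "n \<in> F E" using code_local[OF E hd] n by blast
  qed
  have "admissible B W"
  proof (rule admissible_finiteI[OF fin_W admissible_subset[OF admissible_code[OF E] sub] _ moduli_pos])
    fix b assume "b \<in> B" "b \<le> card W"
    then have mod: "(h d + g) mod int b = (d + g) mod int b" for d g
      using h_mod by (simp add: k_def)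
    show "(\<lambda>n. n mod int b) ` W \<subseteq> (\<lambda>n. n mod int b) ` (F C \<union> (\<Union>d\<in>D. (+) (h d) ` F {0}))"
      unfolding W_def image_Un image_UN image_image mod by blast
  qed
  then show ?thesis by (simp add: W_def)
qed

text \<open>
  With two points \<open>g, g'\<close> in the image of \<open>{0}\<close>, every admissible \<open>D\<close> that contains
  \<open>0\<close> could be enlarged by \<open>g' - g\<close>, as \<open>g + D\<close> and \<open>g'\<close> both lie in the
  admissible set of \<open>admissible_code_union\<close> for \<open>C = {}\<close>. This contradicts
  \<open>extend\<close> for \<open>{0}\<close> and \<open>g' - g\<close>.
\<close>
lemma code_singleton:
  assumes extend: "\<And>C c. \<lbrakk>finite C; admissible B C; c \<notin> C\<rbrakk> \<Longrightarrow>
      \<exists>D. finite D \<and> C \<subseteq> D \<and> admissible B D \<and> \<not> admissible B (insert c D)"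
    and "g \<in> F {0}" and "g' \<in> F {0}"
  shows "g' = g"
proof (rule ccontr)
  assume "g' \<noteq> g"
  then obtain D where D: "finite D" "0 \<in> D" "admissible B D" "\<not> admissible B (insert (g' - g) D)"
    using extend[of "{0}" "g' - g"] admissible_singleton[OF moduli(2)] by auto
  have "admissible B (F {} \<union> (\<Union>d\<in>D. (+) d ` F {0}))"
    using D by (intro admissible_code_union) auto
  moreover have "(+) g ` insert (g' - g) D \<subseteq> F {} \<union> (\<Union>d\<in>D. (+) d ` F {0})"
  proof -
    have "g' \<in> (\<Union>d\<in>D. (+) d ` F {0})" using assms(3) D(2) by (intro UN_I[of 0]) auto
    moreover have "g + d \<in> (+) d ` F {0}" for d using assms(2) by (auto simp: add.commute)
    ultimately show ?thesis by auto
  qed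
  ultimately have "admissible B ((+) g ` insert (g' - g) D)" by (rule admissible_subset)
  then show False using D(4) admissible_translate[OF moduli_pos] by blast
qed

end

text \<open>
  If \<open>F C\<close> had a point \<open>n\<close> outside \<open>g + C\<close>, then \<open>n - g\<close> could be added to every
  finite admissible \<open>D \<supseteq> C\<close>, because \<open>F C \<union> (g + D)\<close> is admissible. If a point of
  \<open>g + C\<close> were missing in \<open>F C\<close>, the same argument applies to the inverse code and the
  set \<open>F C\<close>. Arbitrary sets reduce to finite ones since the code is local.
\<close>
theorem invertible_code_is_translation:
  assumes "admissible_code B F R" and "admissible_code B F' R'"
    and inv: "\<And>A. admissible B A \<Longrightarrow> F' (F A) = A" "\<And>A. admissible B A \<Longrightarrow> F (F' A) = A"
    and extend: "\<And>C c. \<lbrakk>finite C; admissible B C; c \<notin> C\<rbrakk> \<Longrightarrow>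
      \<exists>D. finite D \<and> C \<subseteq> D \<and> admissible B D \<and> \<not> admissible B (insert c D)"
  obtains g where "\<And>A. admissible B A \<Longrightarrow> F A = (+) g ` A"
proof -
  interpret F: admissible_code B F R by fact
  interpret F': admissible_code B F' R' by fact
  have zero: "admissible B {n}" for n by (rule admissible_singleton[OF F.moduli(2)])
  have "F {0} \<noteq> {}" using inv(1)[OF zero[of 0]] F'.code_empty by auto
  then obtain g where g: "F {0} = {g}"
    using F.code_singleton[OF extend] by blast
  have "F' {g} = {0}" using inv(1)[OF zero[of 0]] g by simp
  then have g': "F' {0} = {- g}"
    using F'.code_translate[OF zero[of g], of "- g"] by simp
  have fin: "F C = (+) g ` C" if C: "finite C" "admissible B C" for C
  proof (intro equalityI subsetI)
    fix n assume n: "n \<in> F C"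
    show "n \<in> (+) g ` C"
    proof (rule ccontr)
      assume "n \<notin> (+) g ` C"
      then have "n - g \<notin> C" by (auto simp: image_iff)
      then obtain D where D: "finite D" "C \<subseteq> D" "admissible B D"
        "\<not> admissible B (insert (n - g) D)" using extend[OF C] by blast
      have "admissible B (F C \<union> (\<Union>d\<in>D. (+) d ` F {0}))"
        using C D by (intro F.admissible_code_union) (auto simp: Un_absorb1)
      moreover have "(+) g ` insert (n - g) D \<subseteq> F C \<union> (\<Union>d\<in>D. (+) d ` F {0})"
        using n by (auto simp: g)
      ultimately show False
        using F.admissible_subset admissible_translate[OF F.moduli_pos] D(4) by blast
    qed
  next
    fix n assume "n \<in> (+) g ` C"
    then have n: "n - g \<in> C" by auto
    have FC: "finite (F C)" "admissible B (F C)"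
      using C by (rule F.finite_code) (rule F.admissible_code[OF C(2)])
    show "n \<in> F C"
    proof (rule ccontr)
      assume "n \<notin> F C"
      then obtain D where D: "finite D" "F C \<subseteq> D" "admissible B D"
        "\<not> admissible B (insert n D)" using extend[OF FC] by blast
      have "admissible B (F' (F C) \<union> (\<Union>d\<in>D. (+) d ` F' {0}))"
        using FC D by (intro F'.admissible_code_union) (auto simp: Un_absorb1)
      moreover have "(+) (- g) ` insert n D \<subseteq> F' (F C) \<union> (\<Union>d\<in>D. (+) d ` F' {0})"
        using n by (auto simp: g' inv(1)[OF C(2)])
      ultimately show False
        using F.admissible_subset admissible_translate[OF F.moduli_pos] D(4) by blast
    qed
  qed
  have near: "0 \<in> {g - R..g + R}" using F.code_near[OF zero, of g 0] g by auto
  show ?thesis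
  proof (rule that)
    fix A assume A: "admissible B A"
    have "n \<in> F A \<longleftrightarrow> n \<in> (+) g ` A" for n
    proof -
      define C where "C = A \<inter> {n - R..n + R}"
      have C: "finite C" "admissible B C"
        using F.admissible_subset[OF A] by (auto simp: C_def)
      have "n \<in> F A \<longleftrightarrow> n \<in> F C"
        by (rule F.code_local[OF A C(2)]) (auto simp: C_def)
      also have "\<dots> \<longleftrightarrow> n - g \<in> C" using fin[OF C] by force
      also have "\<dots> \<longleftrightarrow> n \<in> (+) g ` A" using near by (force simp: C_def)
      finally show ?thesis .
    qed
    then show "F A = (+) g ` A" by blast
  qed
qed

lemma automorphism_admissible_code:
  assumes "B \<noteq> {}" and "B \<subseteq> {2..}" and f: "f \<in> carrier (Aut (admissible_shift B))"
  obtains R where "admissible_code B (\<lambda>A. {n. f (\<lambda>i. i \<in> A) n}) R"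
proof -
  define X where "X = admissible_shift B"
  have pos: "\<forall>b\<in>B. b > 0" using assms(2) by auto
  have sub: "subshift X" unfolding X_def by (rule subshift_admissible_shift[OF pos])
  note f = f[folded X_def]
  have X_iff: "(\<lambda>i. i \<in> A) \<in> X \<longleftrightarrow> admissible B A" for A
    by (simp add: X_def admissible_shift_def)
  have fX: "f x \<in> X" if "x \<in> X" for x by (rule Aut_carrierD(2)[OF f that])
  have tr: "f (translate k x) = translate k (f x)" if "x \<in> X" for k x
    by (rule carrier_Aut_translate[OF sub f that])
  have trX: "translate k x \<in> X" if "x \<in> X" for k x
    using translate_mem_iff[OF shift_mem_subshift_iff[OF sub]] that by blast
  have "continuous_on X (\<lambda>x. f x 0)"
    by (rule continuous_on_product_then_coordinatewise[OF carrier_Aut_continuous_on[OF f]])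
  moreover have "closed X" using sub by (simp add: subshift_def)
  ultimately obtain R where
    R: "\<And>x y. \<lbrakk>x \<in> X; y \<in> X; \<forall>i\<in>{-R..R}. x i = y i\<rbrakk> \<Longrightarrow> f x 0 = f y 0"
    using continuous_on_imp_block_code[of X "\<lambda>x. f x 0"] by blast
  have local: "f x n = f y n" if "x \<in> X" "y \<in> X" "\<forall>i\<in>{n - R..n + R}. x i = y i" for x y n
  proof -
    have "f (translate n x) 0 = f (translate n y) 0"
      using that by (intro R trX) (auto simp: translate_apply)
    then show ?thesis using tr that by (simp add: translate_apply)
  qed
  have "admissible_code B (\<lambda>A. {n. f (\<lambda>i. i \<in> A) n}) R"
  proof
    fix A assume A: "admissible B A"
    show "admissible B {n. f (\<lambda>i. i \<in> A) n}"
      using fX X_iff A by (auto simp: X_def admissible_shift_def)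
    fix k
    have "(\<lambda>i. i \<in> (+) k ` A) = translate (- k) (\<lambda>i. i \<in> A)"
      by (force simp: fun_eq_iff translate_apply image_iff)
    then have "f (\<lambda>i. i \<in> (+) k ` A) = translate (- k) (f (\<lambda>i. i \<in> A))"
      using tr A X_iff by simp
    then show "{n. f (\<lambda>i. i \<in> (+) k ` A) n} = (+) k ` {n. f (\<lambda>i. i \<in> A) n}"
      by (force simp: translate_apply image_iff)
  next
    fix A A' :: "int set" and n :: int
    assume *: "admissible B A" "admissible B A'" "A \<inter> {n - R..n + R} = A' \<inter> {n - R..n + R}"
    have "f (\<lambda>i. i \<in> A) n = f (\<lambda>i. i \<in> A') n"
      using * by (intro local) (auto simp: X_iff)
    then show "n \<in> {n. f (\<lambda>i. i \<in> A) n} \<longleftrightarrow> n \<in> {n. f (\<lambda>i. i \<in> A') n}" by simp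
  qed (use assms in auto)
  then show ?thesis by (rule that)
qed

lemma automorphism_is_shift_power:
  assumes "B \<noteq> {}" and B2: "B \<subseteq> {2..}" and f: "f \<in> carrier (Aut (admissible_shift B))"
    and no_K: "\<And>S r. \<lbrakk>finite S; S \<subseteq> B;
        \<forall>r'. residue_union S r' \<subseteq> residue_union S r \<longrightarrow> residue_union S r' = residue_union S r\<rbrakk>
        \<Longrightarrow> \<not> admissible B (- residue_union S r)"
  shows "\<exists>n::int. f = restrict shift (admissible_shift B) [^]\<^bsub>Aut (admissible_shift B)\<^esub> n"
proof -
  define X where "X = admissible_shift B"
  have pos: "\<forall>b\<in>B. b > 0" using B2 by auto
  have sub: "subshift X" unfolding X_def by (rule subshift_admissible_shift[OF pos])
  have X_iff: "x \<in> X \<longleftrightarrow> admissible B {n. x n}" for x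
    by (simp add: X_def admissible_shift_def)
  obtain f' where f': "f' \<in> carrier (Aut X)" and inv: "\<And>x. x \<in> X \<Longrightarrow> f (f' x) = x"
    "\<And>x. x \<in> X \<Longrightarrow> f' (f x) = x"
    using carrier_Aut_inverse[OF sub f[folded X_def]] by metis
  obtain R where F: "admissible_code B (\<lambda>A. {n. f (\<lambda>i. i \<in> A) n}) R"
    using automorphism_admissible_code[OF assms(1-3)] by blast
  obtain R' where F': "admissible_code B (\<lambda>A. {n. f' (\<lambda>i. i \<in> A) n}) R'"
    using automorphism_admissible_code[OF assms(1,2) f'[unfolded X_def]] by blast
  have extend: "\<exists>D. finite D \<and> C \<subseteq> D \<and> admissible B D \<and> \<not> admissible B (insert c D)"
    if "finite C" "admissible B C" "c \<notin> C" for C c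
    by (rule admissible_extension_excluding[OF pos no_K that])
  obtain g where g: "\<And>A. admissible B A \<Longrightarrow> {n. f (\<lambda>i. i \<in> A) n} = (+) g ` A"
    using invertible_code_is_translation[OF F F' _ _ extend] inv X_iff by auto
  have "f = (\<lambda>x\<in>X. \<lambda>m. x (m + - g))"
  proof (rule extensionalityI[OF Aut_carrierD(1)[OF f[folded X_def]] restrict_extensional])
    fix x assume x: "x \<in> X"
    then have "{n. f x n} = (+) g ` {n. x n}" using g[of "{n. x n}"] X_iff by simp
    then have "f x m \<longleftrightarrow> m \<in> (+) g ` {n. x n}" for m by blast
    moreover have "m \<in> (+) g ` {n. x n} \<longleftrightarrow> x (m + - g)" for m by (force simp: image_iff)
    ultimately show "f x = (\<lambda>x\<in>X. \<lambda>m. x (m + - g)) x" using x by (simp add: fun_eq_iff)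
  qed
  then have "f = restrict shift X [^]\<^bsub>Aut X\<^esub> (- g)" by (simp only: shift_pow_int_Aut[OF sub])
  then show ?thesis unfolding X_def by blast
qed

section \<open>Conveyor belts\<close>

text \<open>
  A site \<open>(i, t)\<close> is one of the two bits of the cell that starts at \<open>i\<close>, where
  \<open>t = True\<close> denotes the track that is read from left to right. The belt is described by its
  successor map, given the predicate \<open>C\<close> of starting points of cells of length \<open>N\<close>. The
  link between two adjacent cells is tested by a symmetric condition, so that successor and
  predecessor are inverse to each other on all sites, even on those outside the cells.
\<close>
type_synonym site = "int \<times> bool"

definition succ_site :: "int \<Rightarrow> (int \<Rightarrow> bool) \<Rightarrow> site \<Rightarrow> site" where
  "succ_site N C s = (let (i, t) = s in
     if t then (if C i \<and> C (i + N) then (i + N, True) else (i, False))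
     else (if C i \<and> C (i - N) then (i - N, False) else (i, True)))"

definition pred_site :: "int \<Rightarrow> (int \<Rightarrow> bool) \<Rightarrow> site \<Rightarrow> site" where
  "pred_site N C s = (let (i, t) = s in
     if t then (if C i \<and> C (i - N) then (i - N, True) else (i, False))
     else (if C i \<and> C (i + N) then (i + N, False) else (i, True)))"

lemma pred_succ_site: "pred_site N C (succ_site N C s) = s"
  by (auto simp: succ_site_def pred_site_def split: prod.split)

lemma succ_pred_site: "succ_site N C (pred_site N C s) = s"
  by (auto simp: succ_site_def pred_site_def split: prod.split)

definition walk :: "int \<Rightarrow> (int \<Rightarrow> bool) \<Rightarrow> int \<Rightarrow> site \<Rightarrow> site" where
  "walk N C k s = (if k \<ge> 0 then (succ_site N C ^^ nat k) s else (pred_site N C ^^ nat (- k)) s)"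

lemma walk_0 [simp]: "walk N C 0 s = s"
  by (simp add: walk_def)

lemma walk_succ: "walk N C (k + 1) s = succ_site N C (walk N C k s)"
proof (cases "k \<ge> 0")
  case True
  then have "nat (k + 1) = Suc (nat k)" by simp
  then show ?thesis using True by (simp add: walk_def)
next
  case False
  then have "nat (- k) = Suc (nat (- (k + 1)))" by simp
  then show ?thesis using False by (auto simp: walk_def succ_pred_site)
qed

lemma walk_pred: "walk N C (k - 1) s = pred_site N C (walk N C k s)"
  using walk_succ[of N C "k - 1" s] by (simp add: pred_succ_site)

lemma walk_walk: "walk N C k (walk N C l s) = walk N C (k + l) s"
proof (induction k rule: int_induct[where k = 0])
  case (step1 k)
  have "walk N C (k + 1) (walk N C l s) = walk N C (k + l + 1) s" by (simp only: walk_succ step1(2))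
  then show ?case by (simp add: ac_simps)
next
  case (step2 k)
  have "walk N C (k - 1) (walk N C l s) = walk N C (k + l - 1) s" by (simp only: walk_pred step2(2))
  then show ?case by (simp add: algebra_simps)
qed simp

lemma walk_in_cells:
  assumes "C (fst s)" shows "C (fst (walk N C k s))"
proof (induction k rule: int_induct[where k = 0])
  case (step1 k)
  then show ?case unfolding walk_succ by (auto simp: succ_site_def split: prod.split)
next
  case (step2 k)
  then show ?case unfolding walk_pred by (auto simp: pred_site_def split: prod.split)
qed (use assms in simp)

lemma succ_site_translate:
  "succ_site N C (apfst (\<lambda>i. i + m) s) = apfst (\<lambda>i. i + m) (succ_site N (translate m C) s)"
  by (cases s) (simp add: succ_site_def translate_apply algebra_simps)

lemma pred_site_translate:
  "pred_site N C (apfst (\<lambda>i. i + m) s) = apfst (\<lambda>i. i + m) (pred_site N (translate m C) s)"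
  by (cases s) (simp add: pred_site_def translate_apply algebra_simps)

lemma walk_translate:
  "walk N C k (apfst (\<lambda>i. i + m) s) = apfst (\<lambda>i. i + m) (walk N (translate m C) k s)"
proof (induction k rule: int_induct[where k = 0])
  case (step1 k)
  show ?case by (simp only: walk_succ step1(2) succ_site_translate)
next
  case (step2 k)
  show ?case by (simp only: walk_pred step2(2) pred_site_translate)
qed simp

section \<open>The action of the full shift automorphisms on belts\<close>

definition cell :: "int \<Rightarrow> ((bool \<Rightarrow> bool) \<Rightarrow> int \<Rightarrow> bool) \<Rightarrow> (int \<Rightarrow> bool) \<Rightarrow> int \<Rightarrow> bool" where
  "cell N c x i \<longleftrightarrow> (\<exists>u. \<forall>j\<in>{0..<N}. x (i + j) = c u j)"

text \<open>
  What is needed of a family of words \<open>c u\<close> of length \<open>N\<close>, one for every pair of bits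
  \<open>u\<close>, in order that automorphisms of the full shift can act on the bits: the bit
  \<open>u t\<close> shows at position \<open>p t\<close>, occurrences in a point of \<open>X\<close> do not overlap, cells
  may be exchanged for cells, even infinitely many at once, and cells may be concatenated
  arbitrarily.
\<close>
locale belt_code =
  fixes X :: "(int \<Rightarrow> bool) set" and N :: int
    and c :: "(bool \<Rightarrow> bool) \<Rightarrow> int \<Rightarrow> bool" and p :: "bool \<Rightarrow> int"
  assumes subshift: "subshift X"
    and p_range: "p t \<in> {0..<N}"
    and c_p: "c u (p t) = u t"
    and cells_disjoint: "\<lbrakk>x \<in> X; cell N c x i; cell N c x j; i < j\<rbrakk> \<Longrightarrow> i + N \<le> j"
    and replace_cells: "\<lbrakk>x \<in> X; \<And>n. y n = x n \<or> (\<exists>i. cell N c x i \<and> cell N c y i \<and> n \<in> {i..<i + N})\<rbrakk>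
      \<Longrightarrow> y \<in> X"
    and concat_cells: "(\<lambda>n. c (v (n div N)) (n mod N)) \<in> X"
begin

definition belt :: "(int \<Rightarrow> bool) \<Rightarrow> site \<Rightarrow> int \<Rightarrow> bool" where
  "belt x s k = (let (i, t) = walk N (cell N c x) k s in x (i + p t))"

text \<open>
  Non-overlapping makes the cell around \<open>n\<close> unique on \<open>X\<close>. A choice that is
  defined for all sequences, and that depends only on the cells near \<open>n\<close>, makes the
  map continuous on the whole full shift.
\<close>
definition act :: "((int \<Rightarrow> bool) \<Rightarrow> (int \<Rightarrow> bool)) \<Rightarrow> (int \<Rightarrow> bool) \<Rightarrow> (int \<Rightarrow> bool)" where
  "act \<alpha> x n = (if \<exists>i\<in>{n - N<..n}. cell N c x i
     then let i = (SOME i. i \<in> {n - N<..n} \<and> cell N c x i) in c (\<lambda>t. \<alpha> (belt x (i, t)) 0) (n - i)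
     else x n)"

lemma belt_walk: "belt x (walk N (cell N c x) m s) = translate m (belt x s)"
  by (simp add: fun_eq_iff belt_def walk_walk translate_apply)

lemma cell_unique:
  assumes "x \<in> X" "cell N c x i" "cell N c x j" "n \<in> {i..<i + N}" "n \<in> {j..<j + N}"
  shows "i = j"
  using cells_disjoint[OF assms(1-3)] cells_disjoint[OF assms(1,3,2)] assms(4,5) by force

lemma act_cell:
  assumes "x \<in> X" and "cell N c x i" and "j \<in> {0..<N}"
  shows "act \<alpha> x (i + j) = c (\<lambda>t. \<alpha> (belt x (i, t)) 0) j"
proof -
  have "i' = i" if "i' \<in> {i + j - N<..i + j} \<and> cell N c x i'" for i'
    using cell_unique[OF assms(1) _ assms(2), of i' "i + j"] that assms(3) by auto
  moreover have i: "i \<in> {i + j - N<..i + j} \<and> cell N c x i" using assms(2,3) by auto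
  ultimately have "(SOME i'. i' \<in> {i + j - N<..i + j} \<and> cell N c x i') = i"
    by (intro some_equality) auto
  then show ?thesis using i by (auto simp: act_def Let_def)
qed

lemma act_outside:
  assumes "\<And>i. cell N c x i \<Longrightarrow> n \<notin> {i..<i + N}"
  shows "act \<alpha> x n = x n"
proof -
  have "\<not> cell N c x i" if "i \<in> {n - N<..n}" for i
    using assms[of i] that by auto
  then show ?thesis by (auto simp: act_def)
qed

lemma act_cases:
  assumes "x \<in> X"
  obtains (inside) i j where "cell N c x i" "j \<in> {0..<N}" "n = i + j"
    | (outside) "\<And>i. cell N c x i \<Longrightarrow> n \<notin> {i..<i + N}"
proof (cases "\<exists>i. cell N c x i \<and> n \<in> {i..<i + N}")
  case True
  then obtain i where "cell N c x i" "n \<in> {i..<i + N}" by blast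
  then show ?thesis using inside[of i "n - i"] by auto
next
  case False
  then show ?thesis by (intro outside) blast
qed

lemma cell_actI: "\<lbrakk>x \<in> X; cell N c x i\<rbrakk> \<Longrightarrow> cell N c (act \<alpha> x) i"
  unfolding cell_def[of N c "act \<alpha> x"]
  by (rule exI[of _ "\<lambda>t. \<alpha> (belt x (i, t)) 0"]) (intro ballI act_cell)

lemma act_in_X:
  assumes "x \<in> X" shows "act \<alpha> x \<in> X"
proof (rule replace_cells[OF assms])
  fix n
  show "act \<alpha> x n = x n \<or> (\<exists>i. cell N c x i \<and> cell N c (act \<alpha> x) i \<and> n \<in> {i..<i + N})"
  proof (cases "\<exists>i. cell N c x i \<and> n \<in> {i..<i + N}")
    case True
    then show ?thesis using cell_actI[OF assms] by blast
  next
    case False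
    then have "act \<alpha> x n = x n" by (intro act_outside) blast
    then show ?thesis ..
  qed
qed

text \<open>
  Rewriting creates no new cell: by non-overlapping in the rewritten point, such a cell would
  be disjoint from the rewritten ones, so it was there before.
\<close>
lemma cell_act:
  assumes "x \<in> X" shows "cell N c (act \<alpha> x) = cell N c x"
proof (intro ext iffI)
  fix i assume i: "cell N c (act \<alpha> x) i"
  show "cell N c x i"
  proof (rule ccontr)
    assume not: "\<not> cell N c x i"
    have "act \<alpha> x (i + j) = x (i + j)" if j: "j \<in> {0..<N}" for j
    proof (rule act_outside)
      fix i' assume i': "cell N c x i'"
      show "i + j \<notin> {i'..<i' + N}"
      proof
        assume "i + j \<in> {i'..<i' + N}"
        then have "i = i'"
          using cell_unique[OF act_in_X[OF assms] i cell_actI[OF assms i'], of "i + j"] j by simp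
        then show False using i' not by simp
      qed
    qed
    then have "cell N c x i" using i by (simp add: cell_def)
    then show False using not by blast
  qed
qed (rule cell_actI[OF assms])

text \<open>
  The cells, and with them the belts, are unchanged, so the sequence along the belt of
  \<open>s\<close> in the new point collects the values of \<open>\<alpha>\<close> at \<open>0\<close> on the translates of the
  old sequence. Commutation of \<open>\<alpha>\<close> with translations says that this is the image of the
  old sequence. This is why the rewriting is compatible with composition.
\<close>
lemma belt_act:
  assumes x: "x \<in> X" and cell: "cell N c x (fst s)"
    and \<alpha>: "\<And>k y. \<alpha> (translate k y) = translate k (\<alpha> y)"
  shows "belt (act \<alpha> x) s = \<alpha> (belt x s)"
proof
  fix k
  obtain i t where it: "walk N (cell N c x) k s = (i, t)" by fastforce
  then have i: "cell N c x i" using walk_in_cells[of "cell N c x" s N k] cell by simp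
  have "belt (act \<alpha> x) s k = act \<alpha> x (i + p t)"
    by (simp add: belt_def cell_act[OF x] it)
  also have "\<dots> = \<alpha> (belt x (i, t)) 0"
    by (simp only: act_cell[OF x i p_range] c_p)
  also have "belt x (i, t) = translate k (belt x s)"
    using belt_walk[of x k s] it by simp
  also have "\<alpha> (translate k (belt x s)) 0 = \<alpha> (belt x s) k"
    by (simp add: \<alpha> translate_apply)
  finally show "belt (act \<alpha> x) s k = \<alpha> (belt x s) k" .
qed

lemma act_act:
  assumes x: "x \<in> X" and \<beta>: "\<And>k y. \<beta> (translate k y) = translate k (\<beta> y)"
  shows "act \<alpha> (act \<beta> x) = act (\<lambda>y. \<alpha> (\<beta> y)) x"
proof
  fix n
  have y: "act \<beta> x \<in> X" by (rule act_in_X[OF x])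
  show "act \<alpha> (act \<beta> x) n = act (\<lambda>y. \<alpha> (\<beta> y)) x n"
  proof (rule act_cases[OF x, of n])
    fix i j assume ij: "cell N c x i" "j \<in> {0..<N}" "n = i + j"
    then show ?thesis
      using act_cell[OF y, of i j \<alpha>] act_cell[OF x ij(1,2), of "\<lambda>y. \<alpha> (\<beta> y)"]
        belt_act[OF x _ \<beta>, of "(i, _)"] cell_act[OF x] by simp
  next
    assume out: "\<And>i. cell N c x i \<Longrightarrow> n \<notin> {i..<i + N}"
    have "act \<alpha> (act \<beta> x) n = act \<beta> x n"
    proof (rule act_outside)
      fix i assume "cell N c (act \<beta> x) i"
      then have "cell N c x i" by (simp only: cell_act[OF x])
      then show "n \<notin> {i..<i + N}" by (rule out)
    qed
    then show ?thesis using act_outside[OF out] by simp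
  qed
qed

lemma act_id:
  assumes x: "x \<in> X" shows "act (\<lambda>y. y) x = x"
proof
  fix n
  show "act (\<lambda>y. y) x n = x n"
  proof (rule act_cases[OF x, of n])
    fix i j assume ij: "cell N c x i" "j \<in> {0..<N}" "n = i + j"
    then obtain u where u: "\<And>j. j \<in> {0..<N} \<Longrightarrow> x (i + j) = c u j" by (auto simp: cell_def)
    have "belt x (i, t) 0 = u t" for t
      using u[OF p_range] by (simp add: belt_def c_p)
    then show ?thesis using u[OF ij(2)] act_cell[OF x ij(1,2)] ij(3) by simp
  qed (rule act_outside)
qed

lemma cell_shift: "cell N c (shift x) = translate 1 (cell N c x)"
  by (simp add: fun_eq_iff cell_def shift_def translate_apply ac_simps)

lemma shift_apply: "shift x n = x (n + 1)"
  by (simp add: shift_def)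

lemma belt_shift: "belt (shift x) (i, t) = belt x (i + 1, t)"
proof
  fix k
  obtain a b where ab: "walk N (cell N c (shift x)) k (i, t) = (a, b)" by fastforce
  then have "walk N (cell N c x) k (i + 1, t) = (a + 1, b)"
    using walk_translate[of N "cell N c x" k 1 "(i, t)"] by (simp add: cell_shift)
  then show "belt (shift x) (i, t) k = belt x (i + 1, t) k"
    by (simp add: belt_def ab shift_apply algebra_simps)
qed

lemma act_shift:
  assumes x: "x \<in> X" shows "act \<alpha> (shift x) = shift (act \<alpha> x)"
proof
  fix n
  have y: "shift x \<in> X" using x shift_mem_subshift_iff[OF subshift] by blast
  show "act \<alpha> (shift x) n = shift (act \<alpha> x) n"
  proof (rule act_cases[OF y, of n])
    fix i j assume ij: "cell N c (shift x) i" "j \<in> {0..<N}" "n = i + j"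
    then have "cell N c x (i + 1)" by (simp add: cell_shift translate_apply)
    then show ?thesis
      using act_cell[OF y ij(1,2)] act_cell[OF x, of "i + 1" j] ij(2,3)
      by (simp add: belt_shift shift_apply algebra_simps)
  next
    assume out: "\<And>i. cell N c (shift x) i \<Longrightarrow> n \<notin> {i..<i + N}"
    have "n + 1 \<notin> {i..<i + N}" if "cell N c x i" for i
      using out[of "i - 1"] that by (auto simp: cell_shift translate_apply)
    then show ?thesis using out by (simp add: act_outside shift_apply)
  qed
qed

lemma eventually_coordinate: "\<forall>\<^sub>F y in nhds x. y (n :: int) = (x n :: bool)"
  unfolding eventually_nhds_agree_iff by (rule exI[of _ "{n}"]) simp

lemma eventually_cell: "\<forall>\<^sub>F y in nhds x. cell N c y i = cell N c x i"
proof -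
  have "\<forall>\<^sub>F y in nhds x. \<forall>j\<in>{0..<N}. y (i + j) = x (i + j)"
    by (intro eventually_ball_finite ballI eventually_coordinate) simp
  then show ?thesis by (rule eventually_mono) (simp add: cell_def)
qed

lemma eventually_walk:
  "\<forall>\<^sub>F y in nhds x. walk N (cell N c y) k s = walk N (cell N c x) k s"
proof (induction k rule: int_induct[where k = 0])
  case (step1 k)
  obtain i t where it: "walk N (cell N c x) k s = (i, t)" by fastforce
  show ?case
    using step1(2) eventually_cell[of i x] eventually_cell[of "i + N" x] eventually_cell[of "i - N" x]
    by eventually_elim (simp add: walk_succ it succ_site_def)
next
  case (step2 k)
  obtain i t where it: "walk N (cell N c x) k s = (i, t)" by fastforce
  show ?case
    using step2(2) eventually_cell[of i x] eventually_cell[of "i + N" x] eventually_cell[of "i - N" x]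
    by eventually_elim (simp add: walk_pred it pred_site_def)
qed simp

lemma continuous_belt: "continuous_on UNIV (\<lambda>x. belt x s)"
proof (rule continuous_on_coordinatewise_then_product)
  fix k
  have "\<forall>\<^sub>F y in nhds x. belt y s k = belt x s k" for x
  proof -
    obtain i t where it: "walk N (cell N c x) k s = (i, t)" by fastforce
    show ?thesis
      using eventually_walk[of k s x] eventually_coordinate[of "i + p t" x]
      by eventually_elim (simp add: belt_def it)
  qed
  then show "continuous_on UNIV (\<lambda>x. belt x s k)"
    by (simp add: continuous_on_UNIV_discrete_iff)
qed

lemma continuous_act:
  assumes "continuous_on UNIV \<alpha>" shows "continuous_on X (act \<alpha>)"
proof (rule continuous_on_subset[OF _ subset_UNIV], rule continuous_on_coordinatewise_then_product)
  fix n
  have "continuous_on UNIV (\<lambda>x. \<alpha> (belt x s) 0)" for s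
    by (rule continuous_on_product_then_coordinatewise
        [OF continuous_on_compose2[OF assms continuous_belt subset_UNIV]])
  then have bit: "\<forall>\<^sub>F y in nhds x. \<alpha> (belt y s) 0 = \<alpha> (belt x s) 0" for x s
    by (simp add: continuous_on_UNIV_discrete_iff)
  have "\<forall>\<^sub>F y in nhds x. act \<alpha> y n = act \<alpha> x n" for x
  proof -
    have "\<forall>\<^sub>F y in nhds x. \<forall>i\<in>{n - N<..n}. cell N c y i = cell N c x i"
      by (intro eventually_ball_finite ballI eventually_cell) simp
    moreover have "\<forall>\<^sub>F y in nhds x. \<forall>i\<in>{n - N<..n}. \<forall>t\<in>UNIV. \<alpha> (belt y (i, t)) 0 = \<alpha> (belt x (i, t)) 0"
      by (intro eventually_ball_finite ballI bit) simp_all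
    ultimately show ?thesis using eventually_coordinate[of n x]
    proof eventually_elim
      case (elim y)
      show ?case
      proof (cases "\<exists>i\<in>{n - N<..n}. cell N c x i")
        case True
        define i where "i = (SOME i. i \<in> {n - N<..n} \<and> cell N c x i)"
        have i: "i \<in> {n - N<..n}"
          unfolding i_def using True by (rule someI2_bex) simp
        have "(\<lambda>i. i \<in> {n - N<..n} \<and> cell N c y i) = (\<lambda>i. i \<in> {n - N<..n} \<and> cell N c x i)"
          using elim(1) by blast
        then have "(SOME i. i \<in> {n - N<..n} \<and> cell N c y i) = i" by (simp only: i_def)
        moreover have "\<exists>i\<in>{n - N<..n}. cell N c y i" using True elim(1) by blast
        moreover have "(\<lambda>t. \<alpha> (belt y (i, t)) 0) = (\<lambda>t. \<alpha> (belt x (i, t)) 0)"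
          using elim(2) i by blast
        ultimately show ?thesis using True by (simp only: act_def i_def[symmetric] Let_def if_True)
      next
        case False
        then have "\<not> (\<exists>i\<in>{n - N<..n}. cell N c y i)" using elim(1) by blast
        then show ?thesis using False elim(3) by (simp only: act_def if_False)
      qed
    qed
  qed
  then show "continuous_on UNIV (\<lambda>x. act \<alpha> x n)"
    by (simp add: continuous_on_UNIV_discrete_iff)
qed

text \<open>
  In an infinite concatenation of cells the upper track is a belt of its own, on which any
  sequence \<open>y\<close> can be written.
\<close>
lemma act_faithful:
  assumes "\<And>x. x \<in> X \<Longrightarrow> act \<alpha> x = act \<beta> x"
  shows "\<alpha> y 0 = \<beta> y 0"
proof -
  define z where "z = (\<lambda>n. c (\<lambda>t. y (n div N)) (n mod N))"
  have z: "z \<in> X" unfolding z_def by (rule concat_cells[of "\<lambda>q t. y q"])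
  have z_at: "z (q * N + j) = c (\<lambda>t. y q) j" if "j \<in> {0..<N}" for q j
    using that by (simp add: z_def)
  have cell: "cell N c z (q * N)" for q
    unfolding cell_def by (rule exI[of _ "\<lambda>t. y q"]) (simp add: z_at)
  have walk: "walk N (cell N c z) k (0, True) = (k * N, True)" for k
  proof (induction k rule: int_induct[where k = 0])
    case (step1 k)
    have "k * N + N = (k + 1) * N" by (simp add: algebra_simps)
    then show ?case using cell[of k] cell[of "k + 1"]
      by (simp only: walk_succ step1(2) succ_site_def Let_def prod.case if_True simp_thms)
  next
    case (step2 k)
    have "k * N - N = (k - 1) * N" by (simp add: algebra_simps)
    then show ?case using cell[of k] cell[of "k - 1"]
      by (simp only: walk_pred step2(2) pred_site_def Let_def prod.case if_True simp_thms)
  qed simp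
  have belt: "belt z (0, True) = y"
    using z_at[OF p_range] by (simp add: fun_eq_iff belt_def walk c_p)
  have "act \<gamma> z (0 + p True) = \<gamma> y 0" for \<gamma>
    using act_cell[OF z cell[of 0, simplified] p_range, of \<gamma>] by (simp add: c_p belt)
  then show ?thesis using assms[OF z] by metis
qed

theorem act_monomorphism: "(\<lambda>\<alpha>. \<lambda>x\<in>X. act \<alpha> x) \<in> mon (Aut UNIV) (Aut X)"
proof -
  let ?\<phi> = "\<lambda>\<alpha>. \<lambda>x\<in>X. act \<alpha> x"
  have tr: "\<alpha> (translate k y) = translate k (\<alpha> y)" if "\<alpha> \<in> carrier (Aut UNIV)" for \<alpha> k y
    using carrier_Aut_translate[OF subshift_UNIV that] by blast
  have closed: "?\<phi> \<alpha> \<in> carrier (Aut X)" if \<alpha>: "\<alpha> \<in> carrier (Aut UNIV)" for \<alpha>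
  proof -
    obtain \<beta> where \<beta>: "\<beta> \<in> carrier (Aut UNIV)" "\<And>y. \<alpha> (\<beta> y) = y" "\<And>y. \<beta> (\<alpha> y) = y"
      using carrier_Aut_inverse[OF subshift_UNIV \<alpha>] by (metis UNIV_I)
    have cont: "continuous_on X (?\<phi> \<gamma>)" if "\<gamma> \<in> carrier (Aut UNIV)" for \<gamma>
    proof -
      have "continuous_on X (act \<gamma>)" by (rule continuous_act[OF carrier_Aut_continuous_on[OF that]])
      then show ?thesis by (simp cong: continuous_on_cong)
    qed
    show ?thesis
    proof (rule carrier_AutI[where g = "?\<phi> \<beta>"])
      show "?\<phi> \<alpha> (shift x) = shift (?\<phi> \<alpha> x)" if "x \<in> X" for x
        using that shift_mem_subshift_iff[OF subshift] by (simp add: act_shift)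
    qed (use cont \<alpha> \<beta> tr act_in_X in \<open>auto simp: act_act act_id\<close>)
  qed
  have "?\<phi> \<in> hom (Aut UNIV) (Aut X)"
  proof (rule homI)
    fix \<alpha> \<beta> assume ab: "\<alpha> \<in> carrier (Aut UNIV)" "\<beta> \<in> carrier (Aut UNIV)"
    have "\<alpha> \<otimes>\<^bsub>Aut UNIV\<^esub> \<beta> = (\<lambda>y. \<alpha> (\<beta> y))"
      by (simp add: mult_Aut[OF ab] compose_def fun_eq_iff)
    then have "?\<phi> (\<alpha> \<otimes>\<^bsub>Aut UNIV\<^esub> \<beta>) = (\<lambda>x\<in>X. act (\<lambda>y. \<alpha> (\<beta> y)) x)"
      by simp
    also have "\<dots> = compose X (?\<phi> \<alpha>) (?\<phi> \<beta>)"
      unfolding compose_def by (rule restrict_ext) (simp add: act_in_X act_act tr[OF ab(2)])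
    also have "\<dots> = ?\<phi> \<alpha> \<otimes>\<^bsub>Aut X\<^esub> ?\<phi> \<beta>" using mult_Aut closed ab by simp
    finally show "?\<phi> (\<alpha> \<otimes>\<^bsub>Aut UNIV\<^esub> \<beta>) = ?\<phi> \<alpha> \<otimes>\<^bsub>Aut X\<^esub> ?\<phi> \<beta>" .
  qed (rule closed)
  moreover have "inj_on ?\<phi> (carrier (Aut UNIV))"
  proof (rule inj_onI)
    fix \<alpha> \<beta> assume ab: "\<alpha> \<in> carrier (Aut UNIV)" "\<beta> \<in> carrier (Aut UNIV)" and eq: "?\<phi> \<alpha> = ?\<phi> \<beta>"
    have "act \<alpha> x = act \<beta> x" if "x \<in> X" for x
      using fun_cong[OF eq, of x] that by simp
    then have zero: "\<alpha> y 0 = \<beta> y 0" for y by (rule act_faithful)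
    have "\<alpha> y n = \<beta> y n" for y n
      using zero[of "translate n y"] tr ab by (simp add: translate_apply)
    then show "\<alpha> = \<beta>" by (simp add: fun_eq_iff)
  qed
  ultimately show ?thesis by (simp add: mon_def)
qed

end

section \<open>Cells in the complement of a minimal union of residue classes\<close>

text \<open>
  A witness \<open>(S, r)\<close> of condition (c). The free binary data are placed in translates of the
  complement of its union.
\<close>
locale minimal_residue_union =
  fixes B S :: "nat set" and r :: "nat \<Rightarrow> int"
  assumes moduli: "B \<subseteq> {2..}" and finite_S: "finite S" and S_sub: "S \<subseteq> B"
    and minimal: "\<And>r'. residue_union S r' \<subseteq> residue_union S r \<Longrightarrow> residue_union S r' = residue_union S r"
    and complement_admissible: "admissible B (- residue_union S r)"
begin

definition M :: "int set" where "M = - residue_union S r"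

definition L :: int where "L = (\<Prod>b\<in>S. int b)"

definition period :: "int \<Rightarrow> bool" where
  "period e \<longleftrightarrow> (\<forall>n. n + e \<in> M \<longleftrightarrow> n \<in> M)"

text \<open>
  A cell consists of seven blocks of length \<open>L\<close>: two full copies of the pattern of
  \<open>M\<close>, then blocks \<open>0\<close>, \<open>u True\<close>, \<open>0\<close>, \<open>u False\<close>, \<open>0\<close>, where a
  bit is written as a copy of the pattern or as a zero block. Every window of length
  \<open>2 * L\<close> that begins later inside the cell meets one of the zero blocks, so the double pattern
  marks the beginning of the cell.
\<close>
definition word :: "(bool \<Rightarrow> bool) \<Rightarrow> int \<Rightarrow> bool" where
  "word u j \<longleftrightarrow> j \<in> M \<and> (j < 2 * L \<or> 3 * L \<le> j \<and> j < 4 * L \<and> u True \<or> 5 * L \<le> j \<and> j < 6 * L \<and> u False)"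

lemma moduli_pos: "\<forall>b\<in>B. b > 0"
  using moduli by auto

lemma L_pos: "L > 0"
  unfolding L_def using S_sub moduli_pos by (intro prod_pos) auto

lemma dvd_L: "b \<in> S \<Longrightarrow> int b dvd L"
  unfolding L_def by (rule dvd_prodI[OF finite_S])

lemma residue_union_mult_L: "n + k * L \<in> residue_union S r' \<longleftrightarrow> n \<in> residue_union S r'"
proof -
  have "[n + k * L = r' b] (mod int b) \<longleftrightarrow> [n = r' b] (mod int b)" if b: "b \<in> S" for b
  proof -
    have "[n + k * L = n + 0] (mod int b)"
      using dvd_L[OF b] by (intro cong_add cong_refl) (simp add: cong_0_iff)
    then show ?thesis by (metis add_0_right cong_sym cong_trans)
  qed
  then show ?thesis by (auto simp: mem_residue_union)
qed

lemma mult_L: "n + k * L \<in> M \<longleftrightarrow> n \<in> M"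
  by (simp add: M_def residue_union_mult_L)

lemma period_L: "period L"
  using mult_L[of _ 1] by (simp add: period_def)

lemma mod_L: "n mod L \<in> M \<longleftrightarrow> n \<in> M"
  using mult_L[of "n mod L" "n div L"] by (simp add: add.commute)

text \<open>
  By minimality \<open>K\<close> could cover all integers only if all unions over \<open>S\<close> did, but the
  union of the classes of \<open>0\<close> does not contain \<open>1\<close>.
\<close>
lemma M_nonempty: "M \<noteq> {}"
proof
  assume "M = {}"
  then have "residue_union S r = UNIV" by (auto simp: M_def)
  then have "1 \<in> residue_union S (\<lambda>_. 0)" using minimal[of "\<lambda>_. 0"] by simp
  then obtain b where "b \<in> S" "[1 = 0] (mod int b)" by (auto simp: mem_residue_union)
  then show False using S_sub moduli by (auto simp: cong_0_iff)
qed

lemma period_mult: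
  assumes "period e" shows "n + k * e \<in> M \<longleftrightarrow> n \<in> M"
proof (induction k rule: int_induct[where k = 0])
  case (step1 k)
  have "n + (k + 1) * e = (n + k * e) + e" by (simp add: algebra_simps)
  then show ?case using assms step1 by (simp only: period_def)
next
  case (step2 k)
  have "n + k * e = (n + (k - 1) * e) + e" by (simp add: algebra_simps)
  then show ?case using assms step2 by (simp only: period_def)
qed simp

lemma period_lincomb:
  assumes "period d" shows "period (a * L + b * d)"
  unfolding period_def
proof
  fix n
  have "n + (a * L + b * d) = (n + a * L) + b * d" by simp
  then show "n + (a * L + b * d) \<in> M \<longleftrightarrow> n \<in> M"
    by (simp only: period_mult[OF assms] mult_L)
qed

lemma M_meets_interval:
  assumes "period e" and "e > 0"
  obtains m where "m \<in> M" "a \<le> m" "m < a + e"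
proof -
  obtain m where m: "m \<in> M" using M_nonempty by blast
  have "a + (m - a) mod e = m + (- ((m - a) div e)) * e"
    by (simp add: minus_div_mult_eq_mod[symmetric])
  then have "a + (m - a) mod e \<in> M" using m by (simp only: period_mult[OF assms(1)])
  then show ?thesis using that[of "a + (m - a) mod e"] assms(2) by simp
qed

text \<open>
  For each \<open>b \<in> S\<close> the point \<open>x\<close> avoids some class. The union of these classes, seen
  from \<open>i\<close>, is disjoint from \<open>M\<close> within one period, hence everywhere. So it is contained
  in \<open>K\<close>, and by minimality it is equal to \<open>K\<close>.
\<close>
lemma support_in_frame:
  assumes x: "x \<in> admissible_shift B" and full: "\<And>j. \<lbrakk>j \<in> {0..<L}; j \<in> M\<rbrakk> \<Longrightarrow> x (i + j)"
    and "x n"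
  shows "n - i \<in> M"
proof -
  have "admissible S {n. x n}"
    using x S_sub by (auto simp: admissible_shift_def admissible_def)
  then obtain r' where r': "{n. x n} \<inter> residue_union S r' = {}"
    using admissible_iff_avoids_residue_union[of S "{n. x n}"] S_sub moduli_pos by blast
  define r'' where "r'' b = r' b - i" for b
  have tr: "n \<in> residue_union S r'' \<longleftrightarrow> i + n \<in> residue_union S r'" for n
    by (simp add: mem_residue_union r''_def cong_iff_dvd_diff algebra_simps)
  have "residue_union S r'' \<subseteq> residue_union S r"
  proof
    fix n assume "n \<in> residue_union S r''"
    then have "n mod L \<in> residue_union S r''"
      using residue_union_mult_L[of "n mod L" "n div L" r''] by (simp add: add.commute)
    then have "\<not> x (i + n mod L)" using r' tr by auto
    then have "n mod L \<notin> M" using full[of "n mod L"] L_pos by auto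
    then show "n \<in> residue_union S r" by (simp add: mod_L) (simp add: M_def)
  qed
  then have "residue_union S r'' = residue_union S r" by (rule minimal)
  moreover have "n - i \<notin> residue_union S r''" using tr[of "n - i"] r' assms(3) by auto
  ultimately show ?thesis by (simp add: M_def)
qed

lemma in_frame_admissible:
  assumes "\<And>n. x n \<Longrightarrow> n - i \<in> M" shows "x \<in> admissible_shift B"
proof -
  have "{n. x n} \<subseteq> (+) i ` M"
  proof
    fix n assume "n \<in> {n. x n}"
    then have "n - i \<in> M" using assms by simp
    then show "n \<in> (+) i ` M" by (rule image_eqI[rotated]) simp
  qed
  moreover have "admissible B ((+) i ` M)"
    using complement_admissible by (simp add: admissible_translate[OF moduli_pos] M_def)
  ultimately show ?thesis
    using admissible_mono[OF moduli_pos] by (auto simp: admissible_shift_def)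
qed

lemma cell_word:
  assumes "cell (7 * L) word x i" and "j \<in> {0..<7 * L}"
  shows "x (i + j) \<Longrightarrow> j \<in> M" and "j < 2 * L \<Longrightarrow> j \<in> M \<Longrightarrow> x (i + j)"
    and "2 * L \<le> j \<and> j < 3 * L \<or> 4 * L \<le> j \<and> j < 5 * L \<or> 6 * L \<le> j \<Longrightarrow> \<not> x (i + j)"
  using assms by (auto simp: cell_def word_def)

lemma support_in_cell_frame:
  assumes "x \<in> admissible_shift B" and "cell (7 * L) word x i" and "x n"
  shows "n - i \<in> M"
  using L_pos by (intro support_in_frame[OF assms(1) _ assms(3)] cell_word(2)[OF assms(2)]) auto

text \<open>
  Both cells confine the support to a translate of \<open>M\<close>, and each of them shows one
  complete period of its own translate.
\<close>
lemma cell_frames_agree: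
  assumes "x \<in> admissible_shift B" and "cell (7 * L) word x i" and "cell (7 * L) word x j"
    and "m \<in> M"
  shows "m + (j - i) \<in> M"
proof -
  have "0 \<le> m mod L" "m mod L < 2 * L" "m mod L < 7 * L"
    using L_pos pos_mod_bound[OF L_pos, of m] pos_mod_sign[OF L_pos, of m] by linarith+
  then have "x (j + m mod L)"
    using assms(4) by (intro cell_word(2)[OF assms(3)]) (auto simp: mod_L)
  then have "j + m mod L - i \<in> M" by (rule support_in_cell_frame[OF assms(1,2)])
  then have "j + m mod L - i + m div L * L \<in> M" by (simp only: mult_L)
  moreover have "j + m mod L - i + m div L * L = m + (j - i)"
    using div_mult_mod_eq[of m L] by linarith
  ultimately show ?thesis by simp
qed

text \<open>
  If the distance \<open>d\<close> of two cells is less than their length, then the window of the double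
  pattern of the second cell meets a zero block of the first one. The distance is a period of
  \<open>M\<close>, and in each case the overlap contains an interval whose length is a combination of
  \<open>d\<close> and \<open>L\<close>, so again a period; such an interval contains a point of \<open>M\<close>,
  at which the two cells contradict each other.
\<close>
lemma cells_apart:
  assumes x: "x \<in> admissible_shift B" and i: "cell (7 * L) word x i" and j: "cell (7 * L) word x j"
    and "i < j"
  shows "i + 7 * L \<le> j"
proof (rule ccontr)
  define d where "d = j - i"
  assume "\<not> i + 7 * L \<le> j"
  then have d: "0 < d" "d < 7 * L" using \<open>i < j\<close> by (simp_all add: d_def)
  have per: "period d"
    unfolding period_def
  proof (intro allI iffI)
    fix n
    show "n + d \<in> M" if "n \<in> M" using cell_frames_agree[OF x i j that] by (simp add: d_def)
    show "n \<in> M" if "n + d \<in> M" using cell_frames_agree[OF x j i that] by (simp add: d_def)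
  qed
  have clash: False if m: "m \<in> M" "d \<le> m" "m < d + 2 * L" "m < 7 * L"
    and zero: "2 * L \<le> m \<and> m < 3 * L \<or> 4 * L \<le> m \<and> m < 5 * L \<or> 6 * L \<le> m" for m
  proof -
    have "\<not> x (i + m)" using cell_word(3)[OF i _ zero] m d by auto
    moreover have "m - d \<in> M" using per m(1) unfolding period_def by (metis diff_add_cancel)
    then have "x (j + (m - d))" using m L_pos by (intro cell_word(2)[OF j]) auto
    ultimately show False by (simp add: d_def add.commute)
  qed
  have no_room: False if e: "period e" "e > 0"
    and "d \<le> a" "a + e \<le> d + 2 * L" "a + e \<le> 7 * L"
    and "2 * L \<le> a \<and> a + e \<le> 3 * L \<or> 4 * L \<le> a \<and> a + e \<le> 5 * L \<or> 6 * L \<le> a" for a e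
  proof -
    obtain m where "m \<in> M" "a \<le> m" "m < a + e" by (rule M_meets_interval[OF e])
    then show False using that(3-) by (intro clash[of m]) auto
  qed
  consider "d < L" | "L \<le> d" "d \<le> 2 * L" | "2 * L < d" "d < 3 * L" | "3 * L \<le> d" "d \<le> 4 * L"
    | "4 * L < d" "d < 5 * L" | "5 * L \<le> d" "d \<le> 6 * L" | "6 * L < d"
    by linarith
  then show False
  proof cases
    case 1
    then show ?thesis using d by (intro no_room[of d "2 * L", OF per]) auto
  next
    case 2
    then show ?thesis using L_pos by (intro no_room[of L "2 * L", OF period_L]) auto
  next
    case 3
    then show ?thesis
      using period_lincomb[OF per, of "-2" 1] by (intro no_room[of "d - 2 * L" "4 * L"]) auto
  next
    case 4
    then show ?thesis using L_pos by (intro no_room[of L "4 * L", OF period_L]) auto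
  next
    case 5
    then show ?thesis
      using period_lincomb[OF per, of "-4" 1] by (intro no_room[of "d - 4 * L" "6 * L"]) auto
  next
    case 6
    then show ?thesis using L_pos by (intro no_room[of L "6 * L", OF period_L]) auto
  next
    case 7
    then show ?thesis
      using period_lincomb[OF per, of 7 "-1"] d by (intro no_room[of "7 * L - d" d]) auto
  qed
qed

lemma full_shift_Aut_embeds: "\<exists>\<phi>. \<phi> \<in> mon (Aut UNIV) (Aut (admissible_shift B))"
proof -
  \<comment> \<open>the offset within a block at which the two bits are read\<close>
  obtain m where m: "m \<in> M" "0 \<le> m" "m < L"
    using M_meets_interval[OF period_L L_pos, of 0] by auto
  define p where "p t = (if t then 3 * L else 5 * L) + m" for t
  have p_M: "p t \<in> M" for t
    using mult_L[of m 3] mult_L[of m 5] m(1) by (simp add: p_def add.commute)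
  interpret belt_code "admissible_shift B" "7 * L" word p
  proof
    show "subshift (admissible_shift B)" by (rule subshift_admissible_shift[OF moduli_pos])
    show "p t \<in> {0..<7 * L}" for t using m by (simp add: p_def)
    show "word u (p t) = u t" for u t
      using p_M[of t] m by (cases t) (auto simp: word_def p_def)
    show "i + 7 * L \<le> j" if "x \<in> admissible_shift B" "cell (7 * L) word x i"
      "cell (7 * L) word x j" "i < j" for x i j
      using that by (rule cells_apart)
    show "y \<in> admissible_shift B" if x: "x \<in> admissible_shift B"
      and y: "\<And>n. y n = x n \<or>
        (\<exists>i. cell (7 * L) word x i \<and> cell (7 * L) word y i \<and> n \<in> {i..<i + 7 * L})" for x y
    proof (cases "\<exists>i. cell (7 * L) word x i")
      case False
      then have "y = x" using y by blast
      then show ?thesis using x by simp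
    next
      case True
      then obtain i where i: "cell (7 * L) word x i" by blast
      show ?thesis
      proof (rule in_frame_admissible)
        fix n assume yn: "y n"
        from y[of n] show "n - i \<in> M"
        proof
          assume "y n = x n"
          then show ?thesis using support_in_cell_frame[OF x i] yn by simp
        next
          assume "\<exists>k. cell (7 * L) word x k \<and> cell (7 * L) word y k \<and> n \<in> {k..<k + 7 * L}"
          then obtain k where k: "cell (7 * L) word x k" "cell (7 * L) word y k"
            "n - k \<in> {0..<7 * L}" by auto
          have "n - k \<in> M" using cell_word(1)[OF k(2,3)] yn by simp
          then have "n - k + (k - i) \<in> M" by (rule cell_frames_agree[OF x i k(1)])
          then show ?thesis by simp
        qed
      qed
    qed
    show "(\<lambda>n. word (v (n div (7 * L))) (n mod (7 * L))) \<in> admissible_shift B" for v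
    proof (rule in_frame_admissible[where i = 0])
      fix n assume "word (v (n div (7 * L))) (n mod (7 * L))"
      then have "n mod (7 * L) \<in> M" by (simp add: word_def)
      then have "n mod (7 * L) + (n div (7 * L) * 7) * L \<in> M" by (simp only: mult_L)
      moreover have "n mod (7 * L) + (n div (7 * L) * 7) * L = n"
        using mod_div_mult_eq[of n "7 * L"] by (simp only: mult.assoc)
      ultimately show "n - 0 \<in> M" by simp
    qed
  qed
  show ?thesis using act_monomorphism by blast
qed

end

section \<open>Torsion and the equivalence\<close>

definition flip :: "(int \<Rightarrow> bool) \<Rightarrow> (int \<Rightarrow> bool)" where
  "flip x = (\<lambda>n. \<not> x n)"

lemma flip_in_Aut: "flip \<in> carrier (Aut UNIV)"
proof (rule carrier_AutI[where g = flip])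
  have "continuous_on UNIV (\<lambda>x :: int \<Rightarrow> bool. \<not> x n)" for n
  proof -
    have "\<forall>\<^sub>F y in nhds x. (\<not> y n) = (\<not> x n)" for x :: "int \<Rightarrow> bool"
      unfolding eventually_nhds_agree_iff by (rule exI[of _ "{n}"]) simp
    then show ?thesis by (simp add: continuous_on_UNIV_discrete_iff)
  qed
  then have "continuous_on UNIV (\<lambda>x :: int \<Rightarrow> bool. \<lambda>n. \<not> x n)"
    by (rule continuous_on_coordinatewise_then_product)
  then show "continuous_on UNIV flip" "continuous_on UNIV flip"
    by (simp_all add: flip_def[abs_def])
qed (auto simp: flip_def shift_def)

lemma non_shift_power_if_embeds:
  assumes "B \<subseteq> {2..}" and \<phi>: "\<phi> \<in> mon (Aut UNIV) (Aut (admissible_shift B))"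
  shows "\<exists>f \<in> carrier (Aut (admissible_shift B)). \<forall>n::int.
    f \<noteq> restrict shift (admissible_shift B) [^]\<^bsub>Aut (admissible_shift B)\<^esub> n"
proof (intro bexI allI notI)
  define X where "X = admissible_shift B"
  have sub: "subshift X"
    unfolding X_def using assms(1) by (intro subshift_admissible_shift) auto
  interpret group_hom "Aut UNIV" "Aut X" \<phi>
    using \<phi> group_Aut[OF sub] group_Aut[OF subshift_UNIV]
    by (auto simp: group_hom_def group_hom_axioms_def mon_def X_def)
  have inj: "inj_on \<phi> (carrier (Aut UNIV))" using \<phi> by (simp add: mon_def)
  show "\<phi> flip \<in> carrier (Aut (admissible_shift B))"
    using hom_closed[OF flip_in_Aut] by (simp add: X_def)
  fix n :: int
  assume "\<phi> flip = restrict shift (admissible_shift B) [^]\<^bsub>Aut (admissible_shift B)\<^esub> n"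
  then have \<phi>_flip: "\<phi> flip = (\<lambda>x\<in>X. \<lambda>m. x (m + n))"
    using shift_pow_int_Aut[OF sub] by (simp add: X_def)
  have "flip \<otimes>\<^bsub>Aut UNIV\<^esub> flip = \<one>\<^bsub>Aut UNIV\<^esub>"
    by (simp add: mult_Aut[OF flip_in_Aut flip_in_Aut] one_Aut fun_eq_iff compose_def flip_def)
  then have "\<phi> flip \<otimes>\<^bsub>Aut X\<^esub> \<phi> flip = \<one>\<^bsub>Aut X\<^esub>"
    using hom_mult[OF flip_in_Aut flip_in_Aut] by simp
  then have square: "\<phi> flip (\<phi> flip x) = x" if "x \<in> X" for x
  proof -
    have "compose X (\<phi> flip) (\<phi> flip) x = (\<lambda>x\<in>X. x) x"
      using \<open>\<phi> flip \<otimes>\<^bsub>Aut X\<^esub> \<phi> flip = _\<close>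
      by (simp only: mult_Aut[OF hom_closed[OF flip_in_Aut] hom_closed[OF flip_in_Aut]] one_Aut)
    then show ?thesis using that by (simp add: compose_eq)
  qed
  define e where "e = (\<lambda>m :: int. m = 0)"
  have e: "e \<in> X"
    using admissible_singleton[OF assms(1), of 0] by (simp add: X_def admissible_shift_def e_def)
  have "\<phi> flip e \<in> X" by (rule Aut_carrierD(2)[OF hom_closed[OF flip_in_Aut] e])
  then have "e (m + n + n) = e m" for m
    using fun_cong[OF square[OF e], of m] e by (simp add: \<phi>_flip)
  from this[of 0] have "n = 0" by (simp add: e_def)
  then have "\<phi> flip = \<phi> \<one>\<^bsub>Aut UNIV\<^esub>" using \<phi>_flip by (simp add: one_Aut[of X])
  then have "flip = \<one>\<^bsub>Aut UNIV\<^esub>" 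
    by (rule inj_onD[OF inj _ flip_in_Aut G.one_closed])
  then have "flip e 0 = (\<lambda>x\<in>UNIV. x) e 0" by (simp only: one_Aut)
  then show False by (simp add: flip_def)
qed

theorem theorem2:
  fixes B :: "nat set"
  assumes "B \<noteq> {}" and "B \<subseteq> {2..}" and "primitive B"
  shows "((\<exists>f \<in> carrier (Aut (admissible_shift B)). \<forall>n::int.
              f \<noteq> restrict shift (admissible_shift B) [^]\<^bsub>Aut (admissible_shift B)\<^esub> n)
            \<longleftrightarrow> (\<exists>\<phi>. \<phi> \<in> mon (Aut UNIV) (Aut (admissible_shift B))))
       \<and> ((\<exists>\<phi>. \<phi> \<in> mon (Aut UNIV) (Aut (admissible_shift B)))
            \<longleftrightarrow> (\<exists>S r. finite S \<and> S \<subseteq> B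
                  \<and> (\<forall>r'. residue_union S r' \<subseteq> residue_union S r
                         \<longrightarrow> residue_union S r' = residue_union S r)
                  \<and> admissible B (- residue_union S r)))"
    (is "(?a \<longleftrightarrow> ?b) \<and> (?b \<longleftrightarrow> ?c)")
proof -
  have "?c" if a: "?a"
  proof (rule ccontr)
    assume not_c: "\<not> ?c"
    have no_K: "\<not> admissible B (- residue_union S r)"
      if "finite S" "S \<subseteq> B"
        "\<forall>r'. residue_union S r' \<subseteq> residue_union S r \<longrightarrow> residue_union S r' = residue_union S r"
      for S r
    proof
      assume "admissible B (- residue_union S r)"
      with that have "?c" by (intro exI[of _ S] exI[of _ r] conjI)
      then show False using not_c by (rule notE[rotated])
    qed
    from a obtain f where f: "f \<in> carrier (Aut (admissible_shift B))"
      and not_power: "\<forall>n::int. f \<noteq> restrict shift (admissible_shift B) [^]\<^bsub>Aut (admissible_shift B)\<^esub> n"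
      by (rule bexE)
    from automorphism_is_shift_power[OF assms(1,2) f no_K] obtain n :: int where
      "f = restrict shift (admissible_shift B) [^]\<^bsub>Aut (admissible_shift B)\<^esub> n" by (rule exE)
    then show False by (rule notE[OF spec[OF not_power]])
  qed
  moreover have "?b" if c: "?c"
  proof -
    from c obtain S r where S: "finite S" "S \<subseteq> B"
      "\<forall>r'. residue_union S r' \<subseteq> residue_union S r \<longrightarrow> residue_union S r' = residue_union S r"
      "admissible B (- residue_union S r)" by (elim exE conjE)
    interpret minimal_residue_union B S r
      by unfold_locales (use S assms(2) in blast)+
    show ?thesis by (rule full_shift_Aut_embeds)
  qed
  moreover have "?a" if "?b"
    using that by (rule exE) (rule non_shift_power_if_embeds[OF assms(2)])
  ultimately show ?thesis by (intro conjI iffI) simp_all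
qed

end
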